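(* Let $n,t$ be integers with $0\le t\le n-4$, and let $\mathcal{E}(n,t)$ be the set of trees of order $n$ with exactly $t$ vertices of degree two. Let $T\in\mathcal{E}(n,t)$ have minimum Mostar index among all trees in $\mathcal{E}(n,t)$. (i) If $n-t=5$, then $T\cong F_{n,0,0}$. If $n-t$ is odd and at least $7$, then $T\cong F_{n,\lceil\frac{n-t-5}{4}\rceil-1,\lfloor\frac{n-t-5}{4}\rfloor+1}$. (ii) If $n-t$ is even, then $T\cong C_{n,\lceil\frac{n-t}{4}-\frac12\rceil,\lfloor\frac{n-t}{4}-\frac12\rfloor}$.
   Context: For a connected simple graph $G$, the Mostar index is $Mo(G)=\sum_{uv\in E(G)}|n_u-n_v|$, where for an edge $e=uv$, $n_u$ is the number of vertices of $G$ closer (in graph distance) to $u$ than to $v$, and $n_v$ is the number of vertices closer to $v$ than to $u$. The order of a graph is its number of vertices. For integers $a,b\ge 0$ with $2(a+b)\le n-1$, $C_{n,a,b}$ is the tree obtained from the path $P_{n-a-b}=v_1v_2\dots v_{n-a-b}$ by attaching a pendent vertex $u_i$ to $v_i$ for each $i$ with $2\le i\le a+1$ and each $i$ with $n-a-2b\le i\le n-a-b-1$. In particular $C_{n,0,0}=P_n$, the path on $n$ vertices. For integers $a,b\ge 0$ with $2(a+b)\le n-5$, $F_{n,a,b}$ is the tree obtained from the path $P_{n-a-b-2}=v_1v_2\cdots v_{n-a-b-2}$ by attaching a pendent vertex $u_1$ to $v_2$, and then attaching a pendent vertex $u_i$ to $v_i$ for each $i$ with $2\le i\le a+2$ and each $i$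 with $n-a-2b-2\le i\le n-a-b-3$ (so $v_2$ receives two pendent vertices, $u_1$ and $u_2$). *)

theory Defs
  imports Complex_Main
begin

record 'a ugraph =
  verts :: "'a set"
  edges :: "'a set set"

definition simple_graph :: "'a ugraph \<Rightarrow> bool" where
  "simple_graph G \<longleftrightarrow> finite (verts G) \<and> (\<forall>e\<in>edges G. e \<subseteq> verts G \<and> card e = 2)"

definition adj :: "'a ugraph \<Rightarrow> 'a \<Rightarrow> 'a \<Rightarrow> bool" where
  "adj G u v \<longleftrightarrow> {u, v} \<in> edges G"

text \<open>Walks are nonempty vertex lists; \<open>p\<close> has \<open>length p - 1\<close> edges.\<close>

definition walk :: "'a ugraph \<Rightarrow> 'a list \<Rightarrow> bool" where
  "walk G p \<longleftrightarrow> p \<noteq> [] \<and> set p \<subseteq> verts G \<and> successively (adj G) p"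

definition walk_between :: "'a ugraph \<Rightarrow> 'a \<Rightarrow> 'a list \<Rightarrow> 'a \<Rightarrow> bool" where
  "walk_between G u p v \<longleftrightarrow> walk G p \<and> hd p = u \<and> last p = v"

definition connected_graph :: "'a ugraph \<Rightarrow> bool" where
  "connected_graph G \<longleftrightarrow> verts G \<noteq> {} \<and> (\<forall>u\<in>verts G. \<forall>v\<in>verts G. \<exists>p. walk_between G u p v)"

definition cycle :: "'a ugraph \<Rightarrow> 'a list \<Rightarrow> bool" where
  "cycle G p \<longleftrightarrow> walk G p \<and> distinct p \<and> 3 \<le> length p \<and> adj G (last p) (hd p)"

definition tree :: "'a ugraph \<Rightarrow> bool" where
  "tree G \<longleftrightarrow> simple_graph G \<and> connected_graph G \<and> (\<nexists>p. cycle G p)"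

definition degree :: "'a ugraph \<Rightarrow> 'a \<Rightarrow> nat" where
  "degree G v = card {e \<in> edges G. v \<in> e}"

text \<open>Only meaningful for vertices joined by a walk.\<close>

definition gdist :: "'a ugraph \<Rightarrow> 'a \<Rightarrow> 'a \<Rightarrow> nat" where
  "gdist G u v = (LEAST k. \<exists>p. walk_between G u p v \<and> length p = Suc k)"

text \<open>For an edge \<open>uv\<close>, \<open>closer G u v\<close> is the number written $n_u$ in the Mostar index.\<close>

definition closer :: "'a ugraph \<Rightarrow> 'a \<Rightarrow> 'a \<Rightarrow> nat" where
  "closer G u v = card {w \<in> verts G. gdist G w u < gdist G w v}"

text \<open>The summand of the Mostar index is symmetric in the ends of the edge, so it is a function
  of the unordered pair (see \<open>edge_imbalance_eq\<close>).\<close>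

definition edge_imbalance :: "'a ugraph \<Rightarrow> 'a set \<Rightarrow> int" where
  "edge_imbalance G e = (THE d. \<exists>u v. e = {u, v} \<and> d = \<bar>int (closer G u v) - int (closer G v u)\<bar>)"

lemma edge_imbalance_eq:
  "edge_imbalance G {u, v} = \<bar>int (closer G u v) - int (closer G v u)\<bar>"
  unfolding edge_imbalance_def by (rule the_equality) (auto simp: doubleton_eq_iff)

definition mostar :: "'a ugraph \<Rightarrow> int" where
  "mostar G = (\<Sum>e\<in>edges G. edge_imbalance G e)"

definition isomorphic :: "'a ugraph \<Rightarrow> 'b ugraph \<Rightarrow> bool" where
  "isomorphic G H \<longleftrightarrow> (\<exists>f. bij_betw f (verts G) (verts H) \<and>
     (\<forall>u\<in>verts G. \<forall>v\<in>verts G. adj G u v \<longleftrightarrow> adj H (f u) (f v)))"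

text \<open>Trees of order \<open>n\<close> with exactly \<open>t\<close> vertices of degree two, on vertices from \<open>'a\<close>. As soon as
  this set is inhabited, \<open>'a\<close> has at least \<open>n\<close> elements, so every isomorphism type of such
  trees is represented in it.\<close>

definition trees_deg2 :: "nat \<Rightarrow> nat \<Rightarrow> 'a ugraph set" where
  "trees_deg2 n t = {T. tree T \<and> card (verts T) = n \<and> card {v \<in> verts T. degree T v = 2} = t}"

text \<open>\<open>V i\<close> is the path vertex $v_i$ and \<open>U i\<close> the pendent vertex $u_i$.\<close>

datatype label = V nat | U nat

definition path_edges :: "nat \<Rightarrow> label set set" where
  "path_edges m = {{V i, V (i + 1)} | i. 1 \<le> i \<and> i < m}"

text \<open>In \<open>C_graph\<close> and \<open>F_graph\<close> the subtractions do not truncate when $2(a+b) \le n-1$ and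
  $2(a+b) \le n-5$, respectively, which is where these graphs are considered.\<close>

definition C_graph :: "nat \<Rightarrow> nat \<Rightarrow> nat \<Rightarrow> label ugraph" where
  "C_graph n a b =
     (let m = n - a - b;
          I = {2..a + 1} \<union> {n - a - 2 * b..n - a - b - 1}
      in \<lparr>verts = V ` {1..m} \<union> U ` I,
          edges = path_edges m \<union> {{V i, U i} | i. i \<in> I}\<rparr>)"

definition F_graph :: "nat \<Rightarrow> nat \<Rightarrow> nat \<Rightarrow> label ugraph" where
  "F_graph n a b =
     (let m = n - a - b - 2;
          I = {2..a + 2} \<union> {n - a - 2 * b - 2..n - a - b - 3}
      in \<lparr>verts = V ` {1..m} \<union> {U 1} \<union> U ` I,
          edges = path_edges m \<union> {{V 2, U 1}} \<union> {{V i, U i} | i. i \<in> I}\<rparr>)"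

end

(* In a tree of order n, the summand of an edge e = uv is n - 2 min(n_u, n_v), so minimizing the Mostar
   index means maximizing the sum of the sizes of the smaller sides. For any two vertices x and y,
   twice this sum is at most the sum of all distances from x and from y. Take for x and y the two
   centres of a longest path v_1, ..., v_m. Path vertices contribute |2i - m - 1|; a branch hanging
   off v_i is at most as long as the shorter part of the path, so that its vertices contribute at
   most m - 1, and one neighbour per branching v_i contributes |2i - m - 1| + 2. At least m - 2 - t
   of the v_i are branching, and the resulting bound strictly improves with m up to
   m = (n + t) div 2 + 1, where counting vertices forces the tree to be a caterpillar.

   For a caterpillar, the edges v_i v_(i+1) and v_(m-i) v_(m-i+1) together contribute at least
   2(n - 2i - M_i), where M_i is the number of pendent vertices at the i outermost spine vertices on
   both sides. Equality throughout forces the pendent vertices to be packed at both ends and the two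
   sides to be balanced, which leaves a single caterpillar up to isomorphism. *)

theory Submission
  imports Defs
begin

section \<open>Walks and distances\<close>

text \<open>Write n - t = 2k + 2 + \<epsilon> with \<epsilon> at most 1: in the extremal caterpillar
  k spine vertices carry pendent vertices, and \<epsilon> pendent vertices are left after each has
  received one. The general lower bound never computes the sides of an edge. It charges each edge
  with the side away from a root, and two roots at the middle charge the middle edge of an even path
  once for either side; this is why all estimates concern twice the sum. The resulting bound differs
  from the caterpillar bound only by the parity of n at the middle edge of a spine of even order. So
  a shorter longest path is excluded only if it loses more than this parity, and the available
  margin is 2 + \<epsilon>. For \<epsilon> = 1 the surplus vertex doubles an end position on the
  lighter side. If k = 1, both pendent vertices share one position and cannot be balanced; the
  caterpillar bound may then be missed by 2. This exception is n - t = 5, and the comparison has to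
  be carried out with that tolerance.\<close>

lemma adj_commute: "adj G u v \<longleftrightarrow> adj G v u"
  by (simp add: adj_def insert_commute)

lemma adj_simpleD:
  assumes "simple_graph G" "adj G u v"
  shows "u \<in> verts G" "v \<in> verts G" "u \<noteq> v"
proof -
  have "{u, v} \<subseteq> verts G" "card {u, v} = 2"
    using assms by (auto simp: simple_graph_def adj_def)
  then show "u \<in> verts G" "v \<in> verts G" "u \<noteq> v" by (auto simp: card_2_iff)
qed

lemma edge_adjE:
  assumes "simple_graph G" "e \<in> edges G"
  obtains u v where "e = {u, v}" "adj G u v"
  using assms unfolding simple_graph_def adj_def by (metis card_2_iff)

lemma finite_edges: "simple_graph G \<Longrightarrow> finite (edges G)"
  unfolding simple_graph_def by (meson Pow_iff finite_Pow_iff finite_subset subsetI)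

lemma treeD:
  assumes "tree G"
  shows "simple_graph G" "connected_graph G" "finite (verts G)" "finite (edges G)"
  using assms finite_edges by (auto simp: tree_def simple_graph_def)

lemma walk_appendI:
  "walk G p \<Longrightarrow> walk G q \<Longrightarrow> adj G (last p) (hd q) \<Longrightarrow> walk G (p @ q)"
  by (auto simp: walk_def successively_append_iff)

lemma walk_rev: "walk G (rev p) \<longleftrightarrow> walk G p"
  using adj_commute[of G] by (simp add: walk_def)

lemma walk_between_rev: "walk_between G u p v \<Longrightarrow> walk_between G v (rev p) u"
  unfolding walk_between_def walk_rev by (auto simp: walk_def hd_rev last_rev)

lemma walk_between_append:
  assumes "walk_between G u p v" "walk_between G v q w"
  shows "walk_between G u (p @ tl q) w"
proof (cases "tl q")
  case Nil
  then show ?thesis using assms by (cases q) (auto simp: walk_between_def walk_def)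
next
  case (Cons a r)
  then obtain b where "q = b # a # r" using assms by (cases q) (auto simp: walk_between_def walk_def)
  then show ?thesis using assms by (auto simp: walk_between_def walk_def successively_append_iff)
qed

lemma walk_between_snoc:
  "walk_between G u p v \<Longrightarrow> adj G v w \<Longrightarrow> w \<in> verts G \<Longrightarrow> walk_between G u (p @ [w]) w"
  by (auto simp: walk_between_def walk_def successively_append_iff)

lemma gdist_le: "walk_between G u p v \<Longrightarrow> gdist G u v \<le> length p - 1"
  unfolding gdist_def by (rule Least_le) (auto simp: walk_between_def walk_def intro!: exI[of _ p])

lemma shortest_walk:
  assumes "walk_between G u p v"
  obtains q where "walk_between G u q v" "length q = Suc (gdist G u v)"
proof -
  have "\<exists>k. \<exists>p. walk_between G u p v \<and> length p = Suc k"
    using assms by (auto simp: walk_between_def walk_def intro!: exI[of _ "length p - 1"] exI[of _ p])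
  from LeastI_ex[OF this] show ?thesis using that unfolding gdist_def by blast
qed

lemma gdist_commute: "gdist G u v = gdist G v u"
proof -
  have "(\<exists>p. walk_between G u p v \<and> length p = Suc k) \<Longrightarrow> (\<exists>p. walk_between G v p u \<and> length p = Suc k)"
    for u v k
    using walk_between_rev[of G u _ v] length_rev by metis
  then have "(\<lambda>k. \<exists>p. walk_between G u p v \<and> length p = Suc k) =
      (\<lambda>k. \<exists>p. walk_between G v p u \<and> length p = Suc k)" by (intro ext iffI)
  then show ?thesis by (simp add: gdist_def)
qed

lemma connected_shortest_walk:
  assumes "connected_graph G" "u \<in> verts G" "v \<in> verts G"
  obtains q where "walk_between G u q v" "length q = Suc (gdist G u v)"
  using assms shortest_walk unfolding connected_graph_def by metis

lemma gdist_triangle: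
  assumes "connected_graph G" "u \<in> verts G" "v \<in> verts G" "w \<in> verts G"
  shows "gdist G u w \<le> gdist G u v + gdist G v w"
proof -
  obtain p where p: "walk_between G u p v" "length p = Suc (gdist G u v)"
    using assms connected_shortest_walk by metis
  obtain q where q: "walk_between G v q w" "length q = Suc (gdist G v w)"
    using assms connected_shortest_walk by metis
  show ?thesis using gdist_le[OF walk_between_append[OF p(1) q(1)]] p q by simp
qed

lemma distinct_walk:
  "walk_between G u p v \<Longrightarrow> \<exists>q. walk_between G u q v \<and> distinct q"
proof (induction "length p" arbitrary: p rule: less_induct)
  case less
  show ?case
  proof (cases "distinct p")
    case False
    then obtain xs ys zs y where p: "p = xs @ [y] @ ys @ [y] @ zs"
      using not_distinct_decomp by blast
    have "walk_between G u (xs @ [y] @ zs) v"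
      using less.prems unfolding p
      by (auto simp: walk_between_def walk_def successively_append_iff successively_Cons
          hd_append split: if_splits)
    then show ?thesis using less.hyps[of "xs @ [y] @ zs"] p by simp
  qed (use less.prems in blast)
qed

text \<open>Common tool of the crossing arguments: a walk from inside a set to its outside has a
  first pair of neighbours across the boundary, and everything before that pair stays
  inside.\<close>

lemma list_first_exit:
  assumes "q \<noteq> []" "hd q \<in> A" "last q \<notin> A"
  obtains q1 a b q2 where "q = q1 @ a # b # q2" "set q1 \<subseteq> A" "a \<in> A" "b \<notin> A"
proof -
  have "\<exists>q1 a b q2. q = q1 @ a # b # q2 \<and> set q1 \<subseteq> A \<and> a \<in> A \<and> b \<notin> A"
    using assms
  proof (induction q)
    case (Cons x q)
    show ?case
    proof (cases "q = [] \<or> hd q \<notin> A")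
      case True
      then show ?thesis using Cons.prems
        by (cases q) (auto intro!: exI[of _ "[]"])
    next
      case False
      then obtain q1 a b q2 where "q = q1 @ a # b # q2" "set q1 \<subseteq> A" "a \<in> A" "b \<notin> A"
        using Cons by auto
      then show ?thesis using Cons.prems by (intro exI[of _ "x # q1"]) auto
    qed
  qed simp
  then show ?thesis using that by blast
qed

section \<open>Edge cuts\<close>

text \<open>This encodes that removing the edge from \<open>u\<close> to \<open>v\<close> leaves
  \<open>A\<close> as the side of \<open>u\<close>. The two ends are ordered, which makes
  complementation swap them.\<close>

definition edge_cut :: "'a ugraph \<Rightarrow> 'a set \<Rightarrow> 'a \<Rightarrow> 'a \<Rightarrow> bool" where
  "edge_cut G A u v \<longleftrightarrow> A \<subseteq> verts G \<and> u \<in> A \<and> v \<in> verts G - A \<and> adj G u v \<and>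
     (\<forall>a\<in>A. \<forall>b\<in>verts G - A. adj G a b \<longrightarrow> a = u \<and> b = v)"

lemma edge_cut_Compl:
  assumes "edge_cut G A u v"
  shows "edge_cut G (verts G - A) v u"
proof -
  have "a = v \<and> b = u" if "a \<in> verts G - A" "b \<in> verts G - (verts G - A)" "adj G a b" for a b
  proof -
    have "adj G b a" using that(3) by (simp only: adj_commute)
    then show ?thesis using assms that(1,2) unfolding edge_cut_def by blast
  qed
  moreover have "adj G v u" using assms by (simp only: edge_cut_def adj_commute)
  ultimately show ?thesis using assms unfolding edge_cut_def by blast
qed

text \<open>A shortest walk from \<open>w\<close> to \<open>v\<close> has to leave \<open>A\<close>
  through \<open>u\<close>; stopping there saves at least one step.\<close>

lemma edge_cut_gdist:
  assumes "connected_graph G" "edge_cut G A u v" "w \<in> A"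
  shows "gdist G w u < gdist G w v"
proof -
  have vs: "w \<in> verts G" "v \<in> verts G" "v \<notin> A" using assms by (auto simp: edge_cut_def)
  obtain q where q: "walk_between G w q v" "length q = Suc (gdist G w v)"
    using connected_shortest_walk[OF assms(1) vs(1,2)] .
  then have ends: "hd q = w" "last q = v" "q \<noteq> []" by (auto simp: walk_between_def walk_def)
  have "hd q \<in> A" "last q \<notin> A" using ends assms(3) vs(3) by simp_all
  from list_first_exit[OF ends(3) this]
  obtain q1 a b q2 where s: "q = q1 @ a # b # q2" "set q1 \<subseteq> A" "a \<in> A" "b \<notin> A" .
  have w: "walk G q" using q by (simp add: walk_between_def)
  then have "adj G a b" "b \<in> verts G" using s by (auto simp: walk_def successively_append_iff)
  then have "a = u" using s(3,4) assms(2) unfolding edge_cut_def by blast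
  moreover have "walk G (q1 @ [a])" using w s by (auto simp: walk_def successively_append_iff)
  ultimately have "walk_between G w (q1 @ [a]) u"
    using s ends by (auto simp: walk_between_def hd_append)
  from gdist_le[OF this] show ?thesis using q s by simp
qed

lemma closer_edge_cut:
  assumes "connected_graph G" "edge_cut G A u v"
  shows "closer G u v = card A"
proof -
  have "{w \<in> verts G. gdist G w u < gdist G w v} = A"
  proof (intro equalityI subsetI)
    fix w assume w: "w \<in> {w \<in> verts G. gdist G w u < gdist G w v}"
    then show "w \<in> A"
      using edge_cut_gdist[OF assms(1) edge_cut_Compl[OF assms(2)], of w] by force
  next
    fix w assume "w \<in> A"
    then show "w \<in> {w \<in> verts G. gdist G w u < gdist G w v}"
      using edge_cut_gdist[OF assms] assms(2) by (auto simp: edge_cut_def)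
  qed
  then show ?thesis by (simp add: closer_def)
qed

lemma edge_imbalance_edge_cut:
  assumes "connected_graph G" "finite (verts G)" "edge_cut G A u v"
  shows "edge_imbalance G {u, v} = \<bar>int (card (verts G)) - 2 * int (card A)\<bar>"
proof -
  have A: "A \<subseteq> verts G" using assms by (simp add: edge_cut_def)
  have "int (card (verts G - A)) = int (card (verts G)) - int (card A)"
    using A assms(2) by (simp add: card_Diff_subset card_mono finite_subset of_nat_diff)
  then show ?thesis
    using closer_edge_cut[OF assms(1,3)] closer_edge_cut[OF assms(1) edge_cut_Compl[OF assms(3)]]
    by (simp add: edge_imbalance_eq)
qed

text \<open>Take for \<open>A\<close> what is reachable from \<open>u\<close> after deleting the
  edge. If \<open>v\<close> were reachable too, a walk without repetitions would close up with the
  deleted edge to a cycle.\<close>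

lemma tree_edge_cut:
  assumes "tree G" "adj G u v"
  obtains A where "edge_cut G A u v"
proof -
  note G = treeD[OF assms(1)] adj_simpleD[OF treeD(1)[OF assms(1)] assms(2)]
  define H where "H = G\<lparr>edges := edges G - {{u, v}}\<rparr>"
  have H: "verts H = verts G" "\<And>a b. adj H a b \<longleftrightarrow> adj G a b \<and> {a, b} \<noteq> {u, v}"
    by (auto simp: H_def adj_def)
  define A where "A = {w. \<exists>p. walk_between H u p w}"
  have u: "u \<in> A" using G unfolding A_def
    by (auto simp: walk_between_def walk_def H intro!: exI[of _ "[u]"])
  have sub: "A \<subseteq> verts G" unfolding A_def by (auto simp: walk_between_def walk_def H)
  have v: "v \<notin> A"
  proof
    assume "v \<in> A"
    then obtain p0 where "walk_between H u p0 v" by (auto simp: A_def)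
    from distinct_walk[OF this] obtain p where p: "walk_between H u p v" "distinct p" by blast
    then have ends: "hd p = u" "last p = v" "p \<noteq> []" by (auto simp: walk_between_def walk_def)
    have "successively (adj G) p"
      using p(1) H by (auto simp: walk_between_def walk_def elim!: successively_mono)
    then have w: "walk G p" using p(1) by (auto simp: walk_between_def walk_def H)
    \<comment> \<open>A single vertex is impossible since \<open>u\<close> and \<open>v\<close>
      differ, and two vertices would use the deleted edge.\<close>
    have "3 \<le> length p"
    proof (rule ccontr)
      assume "\<not> 3 \<le> length p"
      moreover have "length p \<noteq> 0" using \<open>p \<noteq> []\<close> by simp
      ultimately have "length p = 1 \<or> length p = 2" by linarith
      then consider x where "p = [x]" | x y where "p = [x, y]"
        by (auto simp: length_Suc_conv numeral_2_eq_2)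
      then show False
      proof cases
        case 1 then show ?thesis using ends G by simp
      next
        case 2 then show ?thesis using ends p(1) by (auto simp: walk_between_def walk_def H)
      qed
    qed
    then have "cycle G p" using w p(2) ends assms(2) by (auto simp: cycle_def adj_commute)
    then show False using assms(1) by (auto simp: tree_def)
  qed
  have "a = u \<and> b = v" if "a \<in> A" "b \<in> verts G - A" "adj G a b" for a b
  proof -
    have "\<not> adj H a b"
      using that(1,2) walk_between_snoc[of H u _ a b] H(1) unfolding A_def by blast
    then have "{a, b} = {u, v}" using H(2)[of a b] that(3) by simp
    then show ?thesis using that u v by (auto simp: doubleton_eq_iff)
  qed
  then have "edge_cut G A u v" unfolding edge_cut_def using sub u v G(6) assms(2) by blast
  then show ?thesis using that by blast
qed

text \<open>Each vertex other than a root \<open>x\<close> has an edge to a vertex nearer to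
  \<open>x\<close>. Two vertices cannot share such an edge, as each would be nearer than the
  other.\<close>

lemma connected_card_edges:
  assumes "simple_graph G" "connected_graph G"
  shows "card (verts G) \<le> Suc (card (edges G))"
proof -
  obtain x where x: "x \<in> verts G" using assms by (auto simp: connected_graph_def)
  have "\<exists>b. adj G b w \<and> gdist G x b < gdist G x w" if w: "w \<in> verts G - {x}" for w
  proof -
    obtain q where q: "walk_between G x q w" "length q = Suc (gdist G x w)"
      using connected_shortest_walk[OF assms(2) x, of w] w by blast
    have ends: "hd q = x" "last q = w" "walk G q" "q \<noteq> []"
      using q by (auto simp: walk_between_def walk_def)
    define r where "r = butlast q"
    have qr: "q = r @ [w]" using ends unfolding r_def by (metis append_butlast_last_id)
    have "r \<noteq> []" using qr ends w by auto
    have "walk G r" "adj G (last r) w"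
      using ends(3) \<open>r \<noteq> []\<close> unfolding qr by (auto simp: walk_def successively_append_iff)
    moreover have "hd r = x" using qr ends \<open>r \<noteq> []\<close> by (auto simp: hd_append)
    ultimately have "walk_between G x r (last r)" by (simp add: walk_between_def)
    from gdist_le[OF this] have "gdist G x (last r) < gdist G x w"
      using q(2) qr \<open>r \<noteq> []\<close> by (cases r) auto
    then show ?thesis using \<open>adj G (last r) w\<close> by blast
  qed
  then obtain f where f: "\<And>w. w \<in> verts G - {x} \<Longrightarrow> adj G (f w) w \<and> gdist G x (f w) < gdist G x w"
    by metis
  have "inj_on (\<lambda>w. {f w, w}) (verts G - {x})"
  proof (rule inj_onI)
    fix w w' assume w: "w \<in> verts G - {x}" "w' \<in> verts G - {x}" "{f w, w} = {f w', w'}"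
    show "w = w'"
    proof (rule ccontr)
      assume "w \<noteq> w'"
      then have "f w = w'" "f w' = w" using w(3) by (auto simp: doubleton_eq_iff)
      then show False using f[OF w(1)] f[OF w(2)] by simp
    qed
  qed
  moreover have "(\<lambda>w. {f w, w}) ` (verts G - {x}) \<subseteq> edges G" using f by (auto simp: adj_def)
  ultimately have "card (verts G - {x}) \<le> card (edges G)"
    using finite_edges[OF assms(1)] by (metis card_inj_on_le)
  then show ?thesis using x assms by (simp add: simple_graph_def card_Diff_singleton)
qed

section \<open>Separating edges and sums of distances\<close>

text \<open>A shortest walk crosses every separating edge, and by \<open>sep\<close> the crossing
  pair determines the edge; the walk has only \<open>gdist G x y\<close> consecutive pairs.\<close>

lemma card_separating_edges_le_gdist:
  assumes "connected_graph G" "finite (edges G)" "x \<in> verts G" "y \<in> verts G"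
    and sep: "\<And>e a b. e \<in> edges G \<Longrightarrow> adj G a b \<Longrightarrow> a \<in> A e \<Longrightarrow> b \<in> verts G - A e \<Longrightarrow> e = {a, b}"
  shows "card {e \<in> edges G. x \<in> A e \<longleftrightarrow> y \<notin> A e} \<le> gdist G x y"
proof -
  obtain q where q: "walk_between G x q y" "length q = Suc (gdist G x y)"
    using assms connected_shortest_walk by metis
  then have ends: "hd q = x" "last q = y" "walk G q" "q \<noteq> []"
    by (auto simp: walk_between_def walk_def)
  let ?S = "(\<lambda>(a, b). {a, b}) ` set (zip q (tl q))"
  have "{e \<in> edges G. x \<in> A e \<longleftrightarrow> y \<notin> A e} \<subseteq> ?S"
  proof clarify
    fix e assume e: "e \<in> edges G" "x \<in> A e \<longleftrightarrow> y \<notin> A e"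
    \<comment> \<open>The side on which \<open>x\<close> lies, so that the walk starts inside
      \<open>B\<close> in either case.\<close>
    define B where "B = (if x \<in> A e then A e else - A e)"
    have "hd q \<in> B" "last q \<notin> B" using ends e by (auto simp: B_def)
    from list_first_exit[OF ends(4) this]
    obtain q1 a b q2 where s: "q = q1 @ a # b # q2" "set q1 \<subseteq> B" "a \<in> B" "b \<notin> B" .
    have ab: "adj G a b" "a \<in> verts G" "b \<in> verts G" using ends(3) unfolding s
      by (auto simp: walk_def successively_append_iff)
    then have "e = {a, b}"
      using s sep[OF e(1), of a b] sep[OF e(1), of b a] adj_commute[of G a b]
      by (auto simp: B_def split: if_splits)
    moreover have "(a, b) \<in> set (zip q (tl q))"
    proof -
      have "q ! length q1 = a" "tl q ! length q1 = b"
        unfolding s by (simp_all add: nth_append nth_tl)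
      then show ?thesis unfolding in_set_zip s(1)
        by (intro exI[of _ "length q1"]) (simp add: s(1))
    qed
    ultimately show "e \<in> ?S" by (force intro: rev_image_eqI)
  qed
  then have "card {e \<in> edges G. x \<in> A e \<longleftrightarrow> y \<notin> A e} \<le> card ?S" by (intro card_mono) auto
  also have "\<dots> \<le> card (set (zip q (tl q)))" by (rule card_image_le) simp
  also have "\<dots> \<le> length (zip q (tl q))" by (rule card_length)
  also have "\<dots> = gdist G x y" using q by simp
  finally show ?thesis .
qed

text \<open>For an edge \<open>e\<close> and a vertex \<open>x\<close>, the imbalance of \<open>e\<close> is at least \<open>n\<close> minus twice the size of
  the side of \<open>e\<close> that does not contain \<open>x\<close>; summed over \<open>e\<close>, these sizes count for each vertex \<open>y\<close>
  the edges separating \<open>y\<close> from \<open>x\<close>.\<close>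

lemma mostar_ge_gdist_sums:
  assumes "tree G" "x \<in> verts G" "y \<in> verts G"
  shows "mostar G \<ge> int (card (verts G)) * (int (card (verts G)) - 1)
    - (\<Sum>w\<in>verts G. int (gdist G x w) + int (gdist G y w))"
proof -
  note G = treeD[OF assms(1)]
  let ?n = "int (card (verts G))"
  have "\<exists>A. \<exists>u v. e = {u, v} \<and> edge_cut G A u v" if e: "e \<in> edges G" for e
  proof -
    obtain u v where "e = {u, v}" "adj G u v" using edge_adjE[OF G(1) e] .
    moreover from this(2) obtain A where "edge_cut G A u v" by (rule tree_edge_cut[OF assms(1)])
    ultimately show ?thesis by blast
  qed
  then obtain A where A: "\<And>e. e \<in> edges G \<Longrightarrow> \<exists>u v. e = {u, v} \<and> edge_cut G (A e) u v"
    by metis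
  have sep: "e = {a, b}" if "e \<in> edges G" "adj G a b" "a \<in> A e" "b \<in> verts G - A e" for e a b
    using A[OF that(1)] that by (auto simp: edge_cut_def)
  define F where "F x e = {w \<in> verts G. x \<in> A e \<longleftrightarrow> w \<notin> A e}" for x e
  have far: "(\<Sum>e\<in>edges G. int (card (F x e))) \<le> (\<Sum>w\<in>verts G. int (gdist G x w))"
    if "x \<in> verts G" for x
  proof -
    have "(\<Sum>e\<in>edges G. card (F x e)) = (\<Sum>w\<in>verts G. card {e \<in> edges G. x \<in> A e \<longleftrightarrow> w \<notin> A e})"
      unfolding F_def by (rule sum_multicount_gen) (use G in auto)
    also have "\<dots> \<le> (\<Sum>w\<in>verts G. gdist G x w)"
      by (intro sum_mono card_separating_edges_le_gdist) (use G that sep in auto)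
    finally show ?thesis by (metis of_nat_le_iff of_nat_sum)
  qed
  have imb: "edge_imbalance G e \<ge> ?n - 2 * int (card (F x e))" if "e \<in> edges G" for e x
  proof -
    from A[OF that] obtain u v where uv: "e = {u, v}" "edge_cut G (A e) u v" by blast
    have sub: "A e \<subseteq> verts G" using uv by (simp add: edge_cut_def)
    have "F x e = (if x \<in> A e then verts G - A e else A e)" using sub by (auto simp: F_def)
    moreover have "int (card (verts G - A e)) = ?n - int (card (A e))"
      using sub G(3) by (simp add: card_Diff_subset card_mono finite_subset of_nat_diff)
    ultimately show ?thesis using edge_imbalance_edge_cut[OF G(2,3) uv(2)] uv(1) by auto
  qed
  have "mostar G \<ge> (\<Sum>e\<in>edges G. ?n - (int (card (F x e)) + int (card (F y e))))"
    unfolding mostar_def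
  proof (rule sum_mono)
    fix e assume "e \<in> edges G"
    then show "?n - (int (card (F x e)) + int (card (F y e))) \<le> edge_imbalance G e"
      using imb[of e x] imb[of e y] by linarith
  qed
  moreover have "(\<Sum>e\<in>edges G. ?n - (int (card (F x e)) + int (card (F y e)))) =
    int (card (edges G)) * ?n - (\<Sum>e\<in>edges G. int (card (F x e))) - (\<Sum>e\<in>edges G. int (card (F y e)))"
    by (simp add: sum_subtractf sum.distrib)
  moreover have "?n * (?n - 1) \<le> int (card (edges G)) * ?n"
    using connected_card_edges[OF G(1,2)]
    by (subst mult.commute, intro mult_right_mono) auto
  ultimately show ?thesis using far[OF assms(2)] far[OF assms(3)] by (simp add: sum.distrib)
qed

section \<open>Longest paths in trees\<close>

text \<open>Turns a degree other than two into a vertex that can be used in constructions: without a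
  third neighbour the two given edges would be all edges at \<open>w\<close>.\<close>

lemma third_neighbour:
  assumes "simple_graph G" "adj G w a" "adj G w b" "a \<noteq> b" "degree G w \<noteq> 2"
  shows "\<exists>z. adj G w z \<and> z \<noteq> a \<and> z \<noteq> b"
proof (rule ccontr)
  assume no: "\<not> ?thesis"
  have "{e \<in> edges G. w \<in> e} = {{w, a}, {w, b}}"
  proof (intro equalityI subsetI)
    fix e assume e: "e \<in> {e \<in> edges G. w \<in> e}"
    then have "e \<in> edges G" by simp
    from edge_adjE[OF assms(1) this] obtain c d where cd: "e = {c, d}" "adj G c d" .
    moreover have "adj G d c" using cd(2) by (simp only: adj_commute)
    ultimately obtain z where "e = {w, z}" "adj G w z" using e by blast
    then show "e \<in> {{w, a}, {w, b}}" using no by blast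
  qed (use assms in \<open>auto simp: adj_def\<close>)
  moreover have "{w, a} \<noteq> {w, b}" using assms(4) by (auto simp: doubleton_eq_iff)
  ultimately show False using assms(5) by (simp add: degree_def)
qed

locale longest_path =
  fixes G :: "'a ugraph" and m :: nat and v :: "nat \<Rightarrow> 'a"
  assumes tree: "tree G" and m_pos: "1 \<le> m" and inj: "inj_on v {1..m}"
    and path_verts: "v ` {1..m} \<subseteq> verts G"
    and step: "\<And>i. 1 \<le> i \<Longrightarrow> i < m \<Longrightarrow> adj G (v i) (v (Suc i))"
    and longest: "\<And>q. walk G q \<Longrightarrow> distinct q \<Longrightarrow> length q \<le> m"
begin

definition off :: "'a set" where "off = verts G - v ` {1..m}"

lemmas G = treeD[OF tree]

lemma v_eq_iff: "i \<in> {1..m} \<Longrightarrow> j \<in> {1..m} \<Longrightarrow> v i = v j \<longleftrightarrow> i = j"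
  using inj by (meson inj_on_eq_iff)

lemma finite_off [simp]: "finite off"
  using G(3) by (simp add: off_def)

lemma card_off: "card off + m = card (verts G)"
proof -
  have c: "card (v ` {1..m}) = m" using card_image[OF inj] by simp
  have "card off = card (verts G) - m"
    unfolding off_def card_Diff_subset[OF finite_imageI[OF finite_atLeastAtMost] path_verts] c ..
  moreover have "m \<le> card (verts G)" using card_mono[OF G(3) path_verts] c by linarith
  ultimately show ?thesis by linarith
qed

lemma v_in_verts: "i \<in> {1..m} \<Longrightarrow> v i \<in> verts G"
  using path_verts by blast

lemma off_notin: "y \<in> off \<Longrightarrow> I \<subseteq> {1..m} \<Longrightarrow> y \<notin> v ` I"
  by (auto simp: off_def)

definition seg :: "nat \<Rightarrow> nat \<Rightarrow> 'a list" where
  "seg i j = map v [i..<Suc j]"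

lemma seg:
  assumes "1 \<le> i" "i \<le> j" "j \<le> m"
  shows "walk G (seg i j)" "distinct (seg i j)" "set (seg i j) = v ` {i..j}"
    "hd (seg i j) = v i" "last (seg i j) = v j" "length (seg i j) = Suc j - i"
proof -
  show "set (seg i j) = v ` {i..j}" by (auto simp: seg_def)
  then have "set (seg i j) \<subseteq> verts G" using assms path_verts by fastforce
  moreover have "successively (adj G) (seg i j)"
    unfolding seg_def using assms step by (auto simp: successively_conv_nth nth_append simp del: upt_Suc)
  ultimately show "walk G (seg i j)" using assms by (auto simp: walk_def seg_def)
  have "inj_on v {i..j}" by (rule inj_on_subset[OF inj]) (use assms in auto)
  moreover have "set [i..<Suc j] = {i..j}" by auto
  ultimately show "distinct (seg i j)" unfolding seg_def distinct_map by (simp only: distinct_upt)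
  show "hd (seg i j) = v i" using assms by (simp add: seg_def hd_map del: upt_Suc)
  show "last (seg i j) = v j" using assms by (simp add: seg_def)
  show "length (seg i j) = Suc j - i" by (simp add: seg_def del: upt_Suc)
qed

lemma no_cycle: "walk G p \<Longrightarrow> distinct p \<Longrightarrow> 3 \<le> length p \<Longrightarrow> \<not> adj G (last p) (hd p)"
  using tree by (auto simp: tree_def cycle_def)

lemma gdist_path_le: "i \<in> {1..m} \<Longrightarrow> j \<in> {1..m} \<Longrightarrow> int (gdist G (v i) (v j)) \<le> \<bar>int i - int j\<bar>"
proof (induction i j rule: linorder_wlog)
  case (le i j)
  then have "walk_between G (v i) (seg i j) (v j)" using seg[of i j] by (simp add: walk_between_def)
  from gdist_le[OF this] show ?case using seg(6)[of i j] le by simp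
next
  case (sym i j)
  then show ?case by (simp add: gdist_commute[of G "v i"] abs_minus_commute)
qed

text \<open>Otherwise the segment between the two path vertices closes up to a cycle. The next two
  lemmas close the same segment through one or two vertices off the path.\<close>

lemma chord:
  assumes "i \<in> {1..m}" "j \<in> {1..m}" "adj G (v i) (v j)"
  shows "j = Suc i \<or> i = Suc j"
proof -
  have False if "Suc i < j" "i \<in> {1..m}" "j \<in> {1..m}" "adj G (v i) (v j)" for i j
  proof -
    have s: "1 \<le> i" "i \<le> j" "j \<le> m" "3 \<le> length (seg i j)" using that by (auto simp: seg_def)
    then show False
      using no_cycle[of "seg i j"] seg[OF s(1-3)] that(4) by (simp add: adj_commute[of G "v j"])
  qed
  moreover have "i \<noteq> j" using assms(3) adj_simpleD(3)[OF G(1)] by blast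
  moreover have "adj G (v j) (v i)" using assms(3) by (simp only: adj_commute)
  ultimately have "\<not> Suc i < j" "\<not> Suc j < i" "i \<noteq> j" using assms by blast+
  then show ?thesis by linarith
qed

lemma attach_unique:
  assumes "y \<in> off" "i \<in> {1..m}" "j \<in> {1..m}" "adj G y (v i)" "adj G y (v j)"
  shows "i = j"
proof -
  have False if "i < j" "i \<in> {1..m}" "j \<in> {1..m}" "adj G y (v i)" "adj G y (v j)" for i j
  proof -
    have s: "1 \<le> i" "i \<le> j" "j \<le> m" using that by auto
    have "walk G ([y] @ seg i j)"
      using seg[OF s] that assms(1) by (intro walk_appendI) (auto simp: walk_def off_def)
    moreover have "distinct ([y] @ seg i j)"
      using seg(2,3)[OF s] s off_notin[OF assms(1), of "{i..j}"] by simp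
    ultimately show False
      using no_cycle[of "[y] @ seg i j"] seg[OF s] that adj_commute[of G y "v j"]
      by (cases "seg i j = []") auto
  qed
  then have "\<not> i < j" "\<not> j < i" using assms by blast+
  then show ?thesis by linarith
qed

lemma attach_not_adj:
  assumes "y \<in> off" "z \<in> off" "i \<in> {1..m}" "j \<in> {1..m}" "adj G y (v i)" "adj G z (v j)"
  shows "\<not> adj G y z"
proof -
  have False if "i \<le> j" "i \<in> {1..m}" "j \<in> {1..m}" "adj G y (v i)" "adj G z (v j)" "adj G y z"
    "y \<in> off" "z \<in> off" for y z i j
  proof -
    have s: "1 \<le> i" "i \<le> j" "j \<le> m" using that by auto
    have "y \<noteq> z" using adj_simpleD(3)[OF G(1)] that by blast
    have "walk G ([y] @ seg i j @ [z])"
      using seg[OF s] that adj_commute[of G z "v j"]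
      by (intro walk_appendI) (auto simp: walk_def off_def hd_append)
    moreover have "distinct ([y] @ seg i j @ [z])"
      using seg(2,3)[OF s] s off_notin[OF that(7), of "{i..j}"] off_notin[OF that(8), of "{i..j}"]
        \<open>y \<noteq> z\<close> by simp
    ultimately show False
      using no_cycle[of "[y] @ seg i j @ [z]"] seg(6)[OF s] s that adj_commute[of G y z] by simp
  qed
  moreover have "i \<le> j \<or> j \<le> i" by linarith
  moreover have "adj G z y" if "adj G y z" using that by (simp only: adj_commute)
  ultimately show ?thesis using assms by blast
qed

text \<open>A shortest branch from \<open>y\<close> to the path, continued along either half of the path, is itself
  a path, hence not longer than the longest one.\<close>

lemma off_branch:
  assumes "y \<in> off"
  obtains i r where "i \<in> {1..m}" "r < i" "r + i \<le> m" "gdist G (v i) y \<le> r"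
proof -
  have y: "y \<in> verts G" "v 1 \<in> verts G" using assms v_in_verts[of 1] m_pos by (auto simp: off_def)
  then obtain p where "walk_between G y p (v 1)"
    using G(2) by (auto simp: connected_graph_def)
  from distinct_walk[OF this] obtain q where q: "walk_between G y q (v 1)" "distinct q" by blast
  then have ends: "hd q = y" "last q = v 1" "q \<noteq> []" "walk G q"
    by (auto simp: walk_between_def walk_def)
  have "hd q \<in> off" "last q \<notin> off" using ends assms m_pos by (auto simp: off_def)
  from list_first_exit[OF ends(3) this]
  obtain q1 a b q2 where s: "q = q1 @ a # b # q2" "set q1 \<subseteq> off" "a \<in> off" "b \<notin> off" .
  \<comment> \<open>The branch from \<open>y\<close> up to its last vertex off the path; the next
    vertex \<open>b\<close> is the attachment point \<open>v i\<close>.\<close>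
  define r where "r = q1 @ [a]"
  have ab: "adj G a b" "b \<in> verts G" "walk G r" using ends(4) unfolding s r_def
    by (auto simp: walk_def successively_append_iff)
  then obtain i where i: "i \<in> {1..m}" "b = v i" using s(4) by (auto simp: off_def)
  have r: "set r \<subseteq> off" "distinct r" "last r = a" "r \<noteq> []" using q(2) s by (auto simp: r_def)
  have hd_r: "hd r = y" using ends(1) s(1) by (simp add: r_def hd_append split: if_splits)
  have disj: "set r \<inter> v ` {1..m} = {}" using r(1) by (auto simp: off_def)
  have s1: "1 \<le> i" "i \<le> m" "m \<le> m" and s2: "1 \<le> (1::nat)" "1 \<le> i" "i \<le> m" using i by auto
  have "set (seg i m) \<subseteq> v ` {1..m}" "set (seg 1 i) \<subseteq> v ` {1..m}"
    using seg(3)[OF s1] seg(3)[OF s2] s1 by auto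
  then have "distinct (r @ seg i m)" "distinct (r @ rev (seg 1 i))"
    using r(2) seg(2)[OF s1] seg(2)[OF s2] disj by auto
  moreover have "walk G (r @ seg i m)"
    using ab i seg[OF s1] r by (intro walk_appendI) auto
  moreover have "hd (rev (seg 1 i)) = v i" using seg(5)[OF s2] by (simp add: hd_rev)
  then have "walk G (r @ rev (seg 1 i))"
    using ab i seg(1)[OF s2] r by (intro walk_appendI) (auto simp: walk_rev)
  \<comment> \<open>Continuing towards \<open>v m\<close> gives \<open>length r < i\<close>,
    continuing towards \<open>v 1\<close> gives \<open>length r + i \<le> m\<close>.\<close>
  ultimately have len: "length r + (Suc m - i) \<le> m" "length r + i \<le> m"
    using longest[of "r @ seg i m"] longest[of "r @ rev (seg 1 i)"] seg(6)[OF s1] seg(6)[OF s2]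
    by auto
  have "walk_between G y (r @ [v i]) (v i)"
    using walk_between_snoc[of G y r a "v i"] ab i hd_r r by (simp add: walk_between_def)
  from gdist_le[OF walk_between_rev[OF this]] have "gdist G (v i) y \<le> length r" by simp
  then show ?thesis using that[of i "length r"] len i by auto
qed

section \<open>Distances from the two centres\<close>

text \<open>For odd \<open>m\<close> both centres are the middle vertex, for even \<open>m\<close>
  they are the ends of the middle edge. They are at most one apart and
  \<open>z1 + z2 = m + 1\<close>, whence the uniform formula \<open>z_abs\<close>.\<close>

definition z1 :: nat where "z1 = (m + 1) div 2"
definition z2 :: nat where "z2 = (m + 2) div 2"

definition centre_dist :: "'a \<Rightarrow> int" where
  "centre_dist y = int (gdist G (v z1) y) + int (gdist G (v z2) y)"

lemma z_bounds: "z1 \<in> {1..m}" "z2 \<in> {1..m}"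
  using m_pos by (auto simp: z1_def z2_def)

lemma z_abs: "\<bar>int z1 - int i\<bar> + \<bar>int z2 - int i\<bar> = \<bar>2 * int i - int m - 1\<bar>"
  unfolding z1_def z2_def by (cases "even m"; elim evenE oddE; simp add: abs_if; presburger)

lemma centre_dist_path:
  assumes "i \<in> {1..m}"
  shows "centre_dist (v i) \<le> \<bar>2 * int i - int m - 1\<bar>"
  using gdist_path_le[OF z_bounds(1) assms] gdist_path_le[OF z_bounds(2) assms] z_abs[of i]
  by (simp add: centre_dist_def)

lemma centre_dist_branch:
  assumes "i \<in> {1..m}" "y \<in> verts G" "gdist G (v i) y \<le> r"
  shows "centre_dist y \<le> \<bar>2 * int i - int m - 1\<bar> + 2 * int r"
proof -
  have "gdist G (v z) y \<le> gdist G (v z) (v i) + r" if "z \<in> {1..m}" for z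
    using gdist_triangle[OF G(2), of "v z" "v i" y] assms v_in_verts[OF that] v_in_verts[OF assms(1)]
    by linarith
  from this[OF z_bounds(1)] this[OF z_bounds(2)] show ?thesis
    using gdist_path_le[OF z_bounds(1) assms(1)] gdist_path_le[OF z_bounds(2) assms(1)] z_abs[of i]
    unfolding centre_dist_def by linarith
qed

lemma centre_dist_attach:
  assumes "i \<in> {1..m}" "adj G (v i) y"
  shows "centre_dist y \<le> \<bar>2 * int i - int m - 1\<bar> + 2"
proof -
  have "walk_between G (v i) [v i, y] y"
    using assms adj_simpleD[OF G(1) assms(2)] by (auto simp: walk_between_def walk_def)
  from gdist_le[OF this] show ?thesis
    using centre_dist_branch[of i y 1] assms adj_simpleD[OF G(1) assms(2)] by simp
qed

text \<open>Moving the attachment point one step towards the middle saves 2 but permits a branch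
  longer by one, which costs 2. The bounds on \<open>r\<close> therefore give the same total at
  every position.\<close>

lemma centre_dist_off:
  assumes "y \<in> off"
  shows "centre_dist y \<le> int m - 1"
proof -
  obtain i r where "i \<in> {1..m}" "r < i" "r + i \<le> m" "gdist G (v i) y \<le> r"
    using off_branch[OF assms] .
  then show ?thesis using centre_dist_branch[of i y r] assms by (auto simp: off_def)
qed

section \<open>Branching positions and their representatives\<close>

definition branching :: "nat set" where
  "branching = {i \<in> {2..m - 1}. degree G (v i) \<noteq> 2}"

lemma finite_branching [simp]: "finite branching"
  by (simp add: branching_def)

lemma card_branching_ge: "m \<le> card branching + card {x \<in> verts G. degree G x = 2} + 2"
proof -
  let ?D = "{i \<in> {2..m - 1}. degree G (v i) = 2}"
  have "card ?D \<le> card {x \<in> verts G. degree G x = 2}"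
  proof (rule card_inj_on_le[where f = v])
    show "inj_on v ?D" using inj by (rule inj_on_subset) auto
    show "v ` ?D \<subseteq> {x \<in> verts G. degree G x = 2}" using path_verts by auto
  qed (use G in auto)
  moreover have "card {2..m - 1} = card (branching \<union> ?D)"
    by (rule arg_cong[where f = card]) (auto simp: branching_def)
  then have "m - 2 \<le> card branching + card ?D"
    using card_Un_le[of branching ?D] by simp
  ultimately show ?thesis by linarith
qed

lemma branching_attach:
  assumes "i \<in> branching"
  shows "\<exists>w\<in>off. adj G (v i) w"
proof -
  have i: "2 \<le> i" "i \<le> m - 1" "i \<in> {1..m}" "degree G (v i) \<noteq> 2"
    using assms by (auto simp: branching_def)
  have "adj G (v (i - 1)) (v i)" "adj G (v i) (v (Suc i))" using step[of "i - 1"] step[of i] i by auto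
  moreover from this(1) have "adj G (v i) (v (i - 1))" by (simp only: adj_commute)
  moreover have "v (i - 1) \<noteq> v (Suc i)" using i by (subst v_eq_iff) auto
  ultimately obtain w where w: "adj G (v i) w" "w \<noteq> v (i - 1)" "w \<noteq> v (Suc i)"
    using third_neighbour[OF G(1), of "v i" "v (i - 1)" "v (Suc i)"] i(4) by blast
  have "w \<noteq> v j" if "j \<in> {1..m}" for j using chord[OF i(3) that] w by auto
  then have "w \<in> off" using adj_simpleD(2)[OF G(1) w(1)] unfolding off_def by blast
  then show ?thesis using w(1) by blast
qed

text \<open>One representative off the path per branching position. By \<open>attach_unique\<close>
  different positions get different representatives, so these vertices can be charged separately
  with a better bound than \<open>m - 1\<close>.\<close>

definition attached :: "nat \<Rightarrow> 'a" where
  "attached i = (SOME w. w \<in> off \<and> adj G (v i) w)"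

lemma attached:
  assumes "i \<in> branching"
  shows "attached i \<in> off" "adj G (v i) (attached i)" "adj G (attached i) (v i)"
proof -
  have "attached i \<in> off \<and> adj G (v i) (attached i)"
    unfolding attached_def using branching_attach[OF assms] by (intro someI_ex[of "\<lambda>w. w \<in> off \<and> adj G (v i) w"]) blast
  then show "attached i \<in> off" "adj G (v i) (attached i)" "adj G (attached i) (v i)"
    using adj_commute[of G "v i"] by auto
qed

lemma branching_subset: "branching \<subseteq> {1..m}"
  by (auto simp: branching_def)

lemma inj_attached: "inj_on attached branching"
proof (rule inj_onI)
  fix i j assume "i \<in> branching" "j \<in> branching" "attached i = attached j"
  then show "i = j"
    using attach_unique[of "attached i" i j] attached[of i] attached[of j] branching_subset
    by (metis subsetD)
qed

lemma card_branching_le: "card branching \<le> card off"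
  by (rule card_inj_on_le[OF inj_attached]) (use attached in auto)

text \<open>A neighbour off the path at either end would extend the longest path.\<close>

lemma attach_inner:
  assumes "y \<in> off" "i \<in> {1..m}" "adj G y (v i)"
  shows "i \<in> {2..m - 1}"
proof -
  have y: "walk G [y]" "y \<notin> v ` {1..m}" using assms by (auto simp: walk_def off_def)
  have s: "1 \<le> (1::nat)" "1 \<le> m" "m \<le> m" using m_pos by auto
  have "i \<noteq> 1"
  proof
    assume "i = 1"
    then have "walk G ([y] @ seg 1 m)"
      using y assms seg[OF s] by (intro walk_appendI) auto
    moreover have "distinct ([y] @ seg 1 m)" using y seg[OF s] by simp
    ultimately show False using longest[of "[y] @ seg 1 m"] seg(6)[OF s] by simp
  qed
  moreover have "i \<noteq> m"
  proof
    assume "i = m"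
    then have "adj G (v m) y" using assms(3) by (simp only: adj_commute)
    then have "walk G (seg 1 m @ [y])"
      using y seg[OF s] by (intro walk_appendI) auto
    moreover have "distinct (seg 1 m @ [y])" using y seg[OF s] by simp
    ultimately show False using longest[of "seg 1 m @ [y]"] seg(6)[OF s] by simp
  qed
  ultimately show ?thesis using assms by auto
qed

text \<open>The vertices fall into three classes, each with its own estimate: the path, the
  representatives, and the remaining vertices off the path, which are charged \<open>m - 1\<close>
  each.\<close>

lemma sum_centre_dist:
  "(\<Sum>y\<in>verts G. centre_dist y) \<le> (\<Sum>i=1..m. \<bar>2 * int i - int m - 1\<bar>)
     + (\<Sum>i\<in>branching. \<bar>2 * int i - int m - 1\<bar> + 2)
     + (int (card off) - int (card branching)) * (int m - 1)"
proof -
  let ?W = "attached ` branching"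
  have W: "?W \<subseteq> off" using attached by blast
  have "verts G = v ` {1..m} \<union> off" "v ` {1..m} \<inter> off = {}" using path_verts by (auto simp: off_def)
  then have "(\<Sum>y\<in>verts G. centre_dist y) = (\<Sum>y\<in>v ` {1..m}. centre_dist y) + (\<Sum>y\<in>off. centre_dist y)"
    using sum.union_disjoint[of "v ` {1..m}" off centre_dist] by simp
  moreover have "(\<Sum>y\<in>v ` {1..m}. centre_dist y) \<le> (\<Sum>i=1..m. \<bar>2 * int i - int m - 1\<bar>)"
    unfolding sum.reindex[OF inj] o_def by (intro sum_mono centre_dist_path)
  moreover have "(\<Sum>y\<in>off. centre_dist y) = (\<Sum>y\<in>off - ?W. centre_dist y) + (\<Sum>y\<in>?W. centre_dist y)"
    by (rule sum.subset_diff[OF W]) simp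
  moreover have "(\<Sum>y\<in>?W. centre_dist y) \<le> (\<Sum>i\<in>branching. \<bar>2 * int i - int m - 1\<bar> + 2)"
    unfolding sum.reindex[OF inj_attached] o_def
    by (intro sum_mono centre_dist_attach) (use branching_subset attached in auto)
  moreover have "(\<Sum>y\<in>off - ?W. centre_dist y) \<le> int (card (off - ?W)) * (int m - 1)"
    using sum_bounded_above[of "off - ?W" centre_dist "int m - 1"] centre_dist_off by auto
  moreover have "int (card (off - ?W)) = int (card off) - int (card branching)"
    using W card_image[OF inj_attached] card_branching_le
    by (simp add: card_Diff_subset finite_subset of_nat_diff)
  ultimately show ?thesis by simp
qed

lemma mostar_ge_centre_dist:
  "mostar G \<ge> int (card (verts G)) * (int (card (verts G)) - 1) - (\<Sum>y\<in>verts G. centre_dist y)"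
  using mostar_ge_gdist_sums[OF tree v_in_verts[OF z_bounds(1)] v_in_verts[OF z_bounds(2)]]
  by (simp add: centre_dist_def)

end

lemma ex_longest_path:
  assumes "tree G"
  shows "\<exists>m v. longest_path G m v"
proof -
  note G = treeD[OF assms]
  let ?P = "\<lambda>q. walk G q \<and> distinct q"
  obtain x where "x \<in> verts G" using G(2) by (auto simp: connected_graph_def)
  then have "?P [x]" by (simp add: walk_def)
  moreover have "length q < Suc (card (verts G))" if "?P q" for q
    using that card_mono[OF G(3), of "set q"] by (simp add: distinct_card walk_def)
  ultimately obtain p where p: "?P p" and max: "\<And>q. ?P q \<Longrightarrow> length q \<le> length p"
    using ex_has_greatest_nat[of ?P "[x]" length "Suc (card (verts G))"] by blast
  define v where "v i = p ! (i - 1)" for i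
  have "longest_path G (length p) v"
  proof
    show "1 \<le> length p" using p by (cases p) (auto simp: walk_def)
    show "inj_on v {1..length p}"
      using p by (auto simp: inj_on_def v_def nth_eq_iff_index_eq)
    show "v ` {1..length p} \<subseteq> verts G"
      using p nth_mem by (fastforce simp: v_def walk_def)
    show "adj G (v i) (v (Suc i))" if "1 \<le> i" "i < length p" for i
      using p that successively_nth[of "adj G" p "i - 1"] by (auto simp: v_def walk_def)
  qed (use assms max in auto)
  then show ?thesis by blast
qed

section \<open>Caterpillars\<close>

text \<open>\<open>v 1, \<dots>, v m\<close> is the spine and \<open>p x\<close> is the position at which the pendent vertex \<open>x\<close> is attached.\<close>

locale caterpillar =
  fixes G :: "'a ugraph" and m :: nat and v :: "nat \<Rightarrow> 'a" and X :: "'a set" and p :: "'a \<Rightarrow> nat"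
  assumes m2: "2 \<le> m" and finite_X: "finite X" and inj: "inj_on v {1..m}"
    and disj: "v ` {1..m} \<inter> X = {}" and p_inner: "\<And>x. x \<in> X \<Longrightarrow> p x \<in> {2..m - 1}"
    and verts_eq: "verts G = v ` {1..m} \<union> X"
    and edges_eq: "edges G = (\<lambda>i. {v i, v (Suc i)}) ` {1..<m} \<union> (\<lambda>x. {v (p x), x}) ` X"
begin

lemma v_eq_iff: "i \<in> {1..m} \<Longrightarrow> j \<in> {1..m} \<Longrightarrow> v i = v j \<longleftrightarrow> i = j"
  using inj by (meson inj_on_eq_iff)

lemma v_neq: "i \<in> {1..m} \<Longrightarrow> x \<in> X \<Longrightarrow> v i \<noteq> x"
  using disj by blast

lemma p_mem: "x \<in> X \<Longrightarrow> p x \<in> {1..m}"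
  using p_inner[of x] by auto

lemma card_verts: "card (verts G) = m + card X"
  unfolding verts_eq using card_Un_disjoint[OF _ finite_X disj] card_image[OF inj] by simp

lemma finite_verts: "finite (verts G)"
  using finite_X by (simp add: verts_eq)

lemma adj_vv:
  assumes "i \<in> {1..m}" "j \<in> {1..m}"
  shows "adj G (v i) (v j) \<longleftrightarrow> j = Suc i \<or> i = Suc j"
proof -
  have "{v i, v j} \<noteq> {v (p x), x}" if "x \<in> X" for x
    using v_neq[OF assms(1) that] v_neq[OF assms(2) that] by (auto simp: doubleton_eq_iff)
  then have "adj G (v i) (v j) \<longleftrightarrow> (\<exists>k\<in>{1..<m}. {v i, v j} = {v k, v (Suc k)})"
    by (auto simp: adj_def edges_eq)
  also have "\<dots> \<longleftrightarrow> (\<exists>k\<in>{1..<m}. (i = k \<and> j = Suc k) \<or> (i = Suc k \<and> j = k))"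
    by (rule bex_cong) (use assms in \<open>auto simp: doubleton_eq_iff v_eq_iff\<close>)
  also have "\<dots> \<longleftrightarrow> j = Suc i \<or> i = Suc j" using assms by auto
  finally show ?thesis .
qed

lemma adj_vx:
  assumes "i \<in> {1..m}" "x \<in> X"
  shows "adj G (v i) x \<longleftrightarrow> i = p x"
proof -
  have "{v i, x} \<noteq> {v k, v (Suc k)}" if "k \<in> {1..<m}" for k
    using v_neq[OF _ assms(2), of k] v_neq[OF _ assms(2), of "Suc k"] that
    by (auto simp: doubleton_eq_iff)
  moreover have "{v i, x} = {v (p y), y} \<longleftrightarrow> y = x \<and> i = p x" if "y \<in> X" for y
    using v_neq[OF assms(1) that] v_eq_iff[OF assms(1) p_mem[OF assms(2)]]
    by (auto simp: doubleton_eq_iff)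
  ultimately show ?thesis using assms unfolding adj_def edges_eq by blast
qed

lemma not_adj_xx:
  assumes "x \<in> X" "y \<in> X"
  shows "\<not> adj G x y"
proof -
  have "{x, y} \<noteq> {v k, v (Suc k)}" if "k \<in> {1..<m}" for k
    using v_neq[OF _ assms(1), of k] v_neq[OF _ assms(2), of k] that by (auto simp: doubleton_eq_iff)
  moreover have "{x, y} \<noteq> {v (p z), z}" if "z \<in> X" for z
    using v_neq[OF p_mem[OF that] assms(1)] v_neq[OF p_mem[OF that] assms(2)]
    by (auto simp: doubleton_eq_iff)
  ultimately show ?thesis unfolding adj_def edges_eq by blast
qed

lemma v_in_verts: "i \<in> {1..m} \<Longrightarrow> v i \<in> verts G"
  by (simp add: verts_eq)

lemma verts_cases:
  assumes "w \<in> verts G"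
  obtains i where "i \<in> {1..m}" "w = v i" | "w \<in> X"
  using assms unfolding verts_eq by blast

lemma simple: "simple_graph G"
  unfolding simple_graph_def
proof (intro conjI ballI)
  fix e assume "e \<in> edges G"
  then consider i where "i \<in> {1..<m}" "e = {v i, v (Suc i)}" | x where "x \<in> X" "e = {v (p x), x}"
    unfolding edges_eq by blast
  then have "e \<subseteq> verts G \<and> card e = 2"
  proof cases
    case 1
    then show ?thesis using v_eq_iff[of i "Suc i"] by (auto simp: verts_eq)
  next
    case 2
    then show ?thesis using v_neq[OF p_mem] p_mem by (auto simp: verts_eq)
  qed
  then show "e \<subseteq> verts G" "card e = 2" by auto
qed (rule finite_verts)

lemma connected: "connected_graph G"
proof -
  have spine: "\<exists>q. walk_between G (v 1) q (v i)" if "1 \<le> i" "i \<le> m" for i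
    using that
  proof (induction i rule: nat_induct_at_least)
    case base
    then show ?case using v_in_verts[of 1]
      by (auto simp: walk_between_def walk_def intro!: exI[of _ "[v 1]"])
  next
    case (Suc i)
    then obtain q where "walk_between G (v 1) q (v i)" by auto
    from walk_between_snoc[OF this, of "v (Suc i)"] show ?case
      using Suc adj_vv[of i "Suc i"] v_in_verts[of "Suc i"] by auto
  qed
  have root: "\<exists>q. walk_between G (v 1) q w" if "w \<in> verts G" for w
    using that
  proof (cases rule: verts_cases)
    case (1 i)
    then show ?thesis using spine[of i] by auto
  next
    case 2
    then obtain q where "walk_between G (v 1) q (v (p w))" using spine[of "p w"] p_mem[of w] by auto
    from walk_between_snoc[OF this, of w] show ?thesis
      using 2 adj_vx[of "p w" w] p_mem[of w] that by blast
  qed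
  have "verts G \<noteq> {}" using v_in_verts[of 1] m2 by auto
  moreover have "\<exists>q. walk_between G a q b" if "a \<in> verts G" "b \<in> verts G" for a b
  proof -
    from root[OF that(1)] obtain q where "walk_between G (v 1) q a" ..
    moreover from root[OF that(2)] obtain r where "walk_between G (v 1) r b" ..
    ultimately have "walk_between G a (rev q @ tl r) b" by (rule walk_between_append[OF walk_between_rev])
    then show ?thesis ..
  qed
  ultimately show ?thesis by (simp add: connected_graph_def)
qed

definition pend_le :: "nat \<Rightarrow> nat" where
  "pend_le i = card {x \<in> X. p x \<le> i}"

lemma edge_cut_spine:
  assumes "i \<in> {1..<m}"
  shows "edge_cut G (v ` {1..i} \<union> {x \<in> X. p x \<le> i}) (v i) (v (Suc i))"
proof -
  let ?A = "v ` {1..i} \<union> {x \<in> X. p x \<le> i}"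
  have v_mem: "v j \<in> ?A \<longleftrightarrow> j \<le> i" if "j \<in> {1..m}" for j
    using that assms v_neq[OF that] v_eq_iff[OF that] by fastforce
  have x_mem: "x \<in> ?A \<longleftrightarrow> p x \<le> i" if "x \<in> X" for x
    using that assms v_neq[OF _ that] by fastforce
  have "a = v i \<and> b = v (Suc i)" if "a \<in> ?A" "b \<in> verts G - ?A" "adj G a b" for a b
  proof -
    have "a \<in> verts G" using that(1) assms by (auto simp: verts_eq)
    then show ?thesis
    proof (cases rule: verts_cases)
      case (1 j)
      have "b \<in> verts G" using that(2) by simp
      then show ?thesis
      proof (cases rule: verts_cases)
        case (1 k)
        have "j \<le> i" using v_mem[OF \<open>j \<in> {1..m}\<close>] that(1) \<open>a = v j\<close> by simp
        moreover have "\<not> k \<le> i" using v_mem[OF 1(1)] that(2) 1(2) by simp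
        moreover have "k = Suc j \<or> j = Suc k"
          using adj_vv[OF \<open>j \<in> {1..m}\<close> 1(1)] that(3) \<open>a = v j\<close> 1(2) by simp
        ultimately have "j = i" "k = Suc i" by linarith+
        then show ?thesis using \<open>a = v j\<close> 1(2) by simp
      next
        case 2
        then show ?thesis
          using \<open>j \<in> {1..m}\<close> \<open>a = v j\<close> that v_mem[of j] x_mem[of b] adj_vx[of j b] by force
      qed
    next
      case 2
      have "b \<in> verts G" using that(2) by simp
      then show ?thesis
      proof (cases rule: verts_cases)
        case (1 k)
        moreover have "adj G b a" using that(3) by (simp only: adj_commute)
        ultimately show ?thesis
          using \<open>a \<in> X\<close> that v_mem[of k] x_mem[of a] adj_vx[of k a] by force
      next
        case b: 2
        then show ?thesis using not_adj_xx[OF 2 b] that by blast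
      qed
    qed
  qed
  moreover have "?A \<subseteq> verts G" using assms by (auto simp: verts_eq)
  moreover have "v i \<in> ?A" using assms by auto
  moreover have "v (Suc i) \<in> verts G - ?A" using v_mem[of "Suc i"] v_in_verts[of "Suc i"] assms by auto
  moreover have "adj G (v i) (v (Suc i))" using adj_vv[of i "Suc i"] assms by auto
  ultimately show ?thesis unfolding edge_cut_def by blast
qed

lemma edge_cut_pendent:
  assumes "x \<in> X"
  shows "edge_cut G {x} x (v (p x))"
proof -
  have "b = v (p x)" if "b \<in> verts G" "adj G x b" for b
    using that(1)
  proof (cases rule: verts_cases)
    case (1 k)
    moreover have "adj G b x" using that(2) by (simp only: adj_commute)
    ultimately show ?thesis using adj_vx[OF _ assms, of k] by simp
  next
    case 2
    then show ?thesis using not_adj_xx[OF assms 2] that by blast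
  qed
  moreover have "adj G x (v (p x))"
    using adj_vx[OF p_mem[OF assms] assms] by (simp only: adj_commute)
  moreover have "v (p x) \<in> verts G - {x}" "x \<in> verts G"
    using assms p_mem[OF assms] v_neq[OF p_mem[OF assms] assms] by (auto simp: verts_eq)
  ultimately show ?thesis unfolding edge_cut_def by blast
qed

text \<open>Every edge is a cut edge, in particular the one that closes a supposed cycle
  \<open>q\<close>. Walking along \<open>q\<close> from its head to its last vertex also crosses
  this cut, hence by the same edge; as vertices do not repeat, \<open>q\<close> has just two of
  them.\<close>

lemma tree: "tree G"
proof -
  have False if q: "cycle G q" for q
  proof -
    have q': "walk G q" "distinct q" "3 \<le> length q" "{last q, hd q} \<in> edges G" "q \<noteq> []"
      using q by (auto simp: cycle_def adj_def walk_def)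
    have "\<exists>A u w. {last q, hd q} = {u, w} \<and> edge_cut G A u w"
    proof -
      from q'(4) consider i where "i \<in> {1..<m}" "{last q, hd q} = {v i, v (Suc i)}"
        | x where "x \<in> X" "{last q, hd q} = {x, v (p x)}"
        unfolding edges_eq by (auto simp: insert_commute)
      then show ?thesis
        by cases (blast intro: edge_cut_spine edge_cut_pendent)+
    qed
    then obtain A where A: "edge_cut G A (last q) (hd q)"
      using edge_cut_Compl by (metis doubleton_eq_iff)
    then have "hd q \<in> - A" "last q \<notin> - A" by (auto simp: edge_cut_def)
    from list_first_exit[OF q'(5) this]
    obtain q1 a b q2 where s: "q = q1 @ a # b # q2" "set q1 \<subseteq> - A" "a \<in> - A" "b \<notin> - A" .
    have ab: "adj G a b" "a \<in> verts G" using q'(1) unfolding s(1)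
      by (auto simp: walk_def successively_append_iff)
    then have "adj G b a" by (simp only: adj_commute)
    then have "b = last q \<and> a = hd q" using A ab s(3,4) unfolding edge_cut_def by blast
    moreover have "q1 \<noteq> [] \<Longrightarrow> hd q \<in> set q1" "q2 \<noteq> [] \<Longrightarrow> last q \<in> set q2"
      using s(1) by simp_all
    moreover have "a \<notin> set q1" "b \<notin> set q2" using q'(2) s(1) by simp_all
    ultimately have "q1 = []" "q2 = []" by blast+
    then show False using q'(3) s(1) by simp
  qed
  then show ?thesis using simple connected by (auto simp: tree_def)
qed

lemma inj_spine_edge: "inj_on (\<lambda>i. {v i, v (Suc i)}) {1..<m}"
proof (rule inj_onI)
  fix i j assume "i \<in> {1..<m}" "j \<in> {1..<m}" "{v i, v (Suc i)} = {v j, v (Suc j)}"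
  then show "i = j"
    using v_eq_iff[of i j] v_eq_iff[of i "Suc j"] v_eq_iff[of "Suc i" j]
    by (auto simp: doubleton_eq_iff)
qed

lemma inj_pendent_edge: "inj_on (\<lambda>x. {v (p x), x}) X"
  by (rule inj_onI) (use v_neq[OF p_mem] in \<open>auto simp: doubleton_eq_iff\<close>)

lemma disjoint_edges:
  "(\<lambda>i. {v i, v (Suc i)}) ` {1..<m} \<inter> (\<lambda>x. {v (p x), x}) ` X = {}"
proof -
  have "{v i, v (Suc i)} \<noteq> {v (p x), x}" if "i \<in> {1..<m}" "x \<in> X" for i x
    using v_neq[OF _ that(2), of i] v_neq[OF _ that(2), of "Suc i"] that(1)
    by (auto simp: doubleton_eq_iff)
  then show ?thesis by blast
qed

lemma mostar_eq:
  "mostar G = (\<Sum>i=1..<m. \<bar>int (card (verts G)) - 2 * (int i + int (pend_le i))\<bar>)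
     + int (card X) * (int (card (verts G)) - 2)"
proof -
  note imb = edge_imbalance_edge_cut[OF connected finite_verts]
  have spine: "edge_imbalance G {v i, v (Suc i)} =
      \<bar>int (card (verts G)) - 2 * (int i + int (pend_le i))\<bar>" if "i \<in> {1..<m}" for i
  proof -
    have "inj_on v {1..i}" by (rule inj_on_subset[OF inj]) (use that in auto)
    then have "card (v ` {1..i}) = i" by (simp add: card_image)
    moreover have "v ` {1..i} \<inter> {x \<in> X. p x \<le> i} = {}"
      using disj that by fastforce
    ultimately have "card (v ` {1..i} \<union> {x \<in> X. p x \<le> i}) = i + pend_le i"
      using finite_X by (simp add: card_Un_disjoint pend_le_def)
    then show ?thesis using imb[OF edge_cut_spine[OF that]] by simp
  qed
  have pendent: "edge_imbalance G {v (p x), x} = int (card (verts G)) - 2" if "x \<in> X" for x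
    using imb[OF edge_cut_pendent[OF that]] card_verts m2 by (simp add: insert_commute)
  have "mostar G = (\<Sum>e\<in>(\<lambda>i. {v i, v (Suc i)}) ` {1..<m}. edge_imbalance G e)
      + (\<Sum>e\<in>(\<lambda>x. {v (p x), x}) ` X. edge_imbalance G e)"
    unfolding mostar_def edges_eq by (rule sum.union_disjoint) (use finite_X disjoint_edges in auto)
  also have "\<dots> = (\<Sum>i=1..<m. edge_imbalance G {v i, v (Suc i)})
      + (\<Sum>x\<in>X. edge_imbalance G {v (p x), x})"
    unfolding sum.reindex[OF inj_spine_edge] sum.reindex[OF inj_pendent_edge] o_def ..
  also have "(\<Sum>x\<in>X. edge_imbalance G {v (p x), x}) = (\<Sum>x\<in>X. int (card (verts G)) - 2)"
    by (rule sum.cong[OF refl pendent])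
  also have "(\<Sum>i=1..<m. edge_imbalance G {v i, v (Suc i)}) =
      (\<Sum>i=1..<m. \<bar>int (card (verts G)) - 2 * (int i + int (pend_le i))\<bar>)"
    by (rule sum.cong[OF refl spine])
  finally show ?thesis by simp
qed

lemma degree_pendent:
  assumes "x \<in> X"
  shows "degree G x = 1"
proof -
  have "{e \<in> edges G. x \<in> e} = {{v (p x), x}}"
  proof -
    have "x \<notin> {v i, v (Suc i)}" if "i \<in> {1..<m}" for i
      using v_neq[OF _ assms, of i] v_neq[OF _ assms, of "Suc i"] that by auto
    moreover have "x \<in> {v (p y), y} \<longleftrightarrow> x = y" if "y \<in> X" for y
      using v_neq[OF p_mem[OF that] assms] by auto
    ultimately show ?thesis using assms unfolding edges_eq by fastforce
  qed
  then show ?thesis by (simp add: degree_def)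
qed

text \<open>The spine edge with index \<open>k\<close> joins \<open>v k\<close> and
  \<open>v (Suc k)\<close>, so those at \<open>v i\<close> have indices \<open>i - 1\<close> and
  \<open>i\<close>; the intersection drops the missing one at an end of the spine.\<close>

lemma degree_spine:
  assumes "i \<in> {1..m}"
  shows "degree G (v i) = card ({i - 1, i} \<inter> {1..<m}) + card {x \<in> X. p x = i}"
proof -
  let ?S = "(\<lambda>i. {v i, v (Suc i)}) ` ({i - 1, i} \<inter> {1..<m})"
  let ?P = "(\<lambda>x. {v (p x), x}) ` {x \<in> X. p x = i}"
  have "v i \<in> {v k, v (Suc k)} \<longleftrightarrow> k \<in> {i - 1, i}" if "k \<in> {1..<m}" for k
    using v_eq_iff[OF assms, of k] v_eq_iff[OF assms, of "Suc k"] that assms by auto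
  moreover have "v i \<in> {v (p x), x} \<longleftrightarrow> p x = i" if "x \<in> X" for x
    using v_eq_iff[OF assms p_mem[OF that]] v_neq[OF assms that] by auto
  ultimately have "{k \<in> {1..<m}. v i \<in> {v k, v (Suc k)}} = {i - 1, i} \<inter> {1..<m}"
    "{x \<in> X. v i \<in> {v (p x), x}} = {x \<in> X. p x = i}"
    by (intro Collect_cong set_eqI; auto)+
  moreover have "{e \<in> edges G. v i \<in> e} =
      (\<lambda>k. {v k, v (Suc k)}) ` {k \<in> {1..<m}. v i \<in> {v k, v (Suc k)}}
      \<union> (\<lambda>x. {v (p x), x}) ` {x \<in> X. v i \<in> {v (p x), x}}"
    unfolding edges_eq by blast
  ultimately have "{e \<in> edges G. v i \<in> e} = ?S \<union> ?P" by simp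
  moreover have "card (?S \<union> ?P) = card ?S + card ?P"
    by (rule card_Un_disjoint) (use finite_X disjoint_edges in auto)
  moreover have "card ?S = card ({i - 1, i} \<inter> {1..<m})"
    by (rule card_image) (rule inj_on_subset[OF inj_spine_edge], simp)
  moreover have "card ?P = card {x \<in> X. p x = i}"
    by (rule card_image) (rule inj_on_subset[OF inj_pendent_edge], auto)
  ultimately show ?thesis by (simp add: degree_def)
qed

lemma card_degree_two: "card {w \<in> verts G. degree G w = 2} = m - 2 - card (p ` X)"
proof -
  have "degree G (v i) = 2 \<longleftrightarrow> i \<in> {2..m - 1} - p ` X" if i: "i \<in> {1..m}" for i
  proof (cases "i = 1 \<or> i = m")
    case True
    then have "i \<notin> {2..m - 1}" using m2 by auto
    then have "{x \<in> X. p x = i} = {}" using p_inner by blast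
    then have "card {x \<in> X. p x = i} = 0" by (simp only: card.empty)
    moreover have "{i - 1, i} \<inter> {1..<m} = {if i = 1 then 1 else m - 1}" using True m2 by auto
    then have "card ({i - 1, i} \<inter> {1..<m}) = 1" by simp
    ultimately have "degree G (v i) = 1" using degree_spine[OF i] by simp
    then show ?thesis using \<open>i \<notin> {2..m - 1}\<close> by auto
  next
    case False
    then have "{i - 1, i} \<inter> {1..<m} = {i - 1, i}" "i - 1 \<noteq> i" using i by auto
    moreover have "card {x \<in> X. p x = i} = 0 \<longleftrightarrow> i \<notin> p ` X" using finite_X by auto
    ultimately show ?thesis using degree_spine[OF i] False i by auto
  qed
  then have "{w \<in> verts G. degree G w = 2} = v ` ({2..m - 1} - p ` X)"
    using degree_pendent unfolding verts_eq by fastforce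
  moreover have "card (v ` ({2..m - 1} - p ` X)) = card ({2..m - 1} - p ` X)"
    by (rule card_image) (rule inj_on_subset[OF inj], auto)
  moreover have "card ({2..m - 1} - p ` X) = card {2..m - 1} - card (p ` X)"
    by (rule card_Diff_subset) (use finite_X p_inner in auto)
  ultimately show ?thesis by simp
qed

section \<open>Reflection, relabelling and isomorphism of caterpillars\<close>

text \<open>The same graph read from the other end. It allows normalising a minimal tree whose
  heavier end, or whose doubled position, lies on the wrong side.\<close>

lemma reflect: "caterpillar G m (\<lambda>i. v (Suc m - i)) X (\<lambda>x. Suc m - p x)"
proof
  have im: "(\<lambda>i. Suc m - i) ` {1..m} = {1..m}"
  proof (intro equalityI subsetI)
    fix j assume "j \<in> {1..m}"
    then show "j \<in> (\<lambda>i. Suc m - i) ` {1..m}" by (intro image_eqI[where x = "Suc m - j"]) auto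
  qed auto
  have inj': "inj_on (\<lambda>i. Suc m - i) {1..m}" by (auto simp: inj_on_def)
  then show "inj_on (\<lambda>i. v (Suc m - i)) {1..m}"
    using comp_inj_on[OF inj'] im inj by (simp add: o_def)
  have vim: "(\<lambda>i. v (Suc m - i)) ` {1..m} = v ` {1..m}" using im by (metis image_image)
  then show "(\<lambda>i. v (Suc m - i)) ` {1..m} \<inter> X = {}" "verts G = (\<lambda>i. v (Suc m - i)) ` {1..m} \<union> X"
    using disj verts_eq by simp_all
  show "Suc m - p x \<in> {2..m - 1}" if "x \<in> X" for x using p_inner[OF that] by auto
  have "(\<lambda>i. {v (Suc m - i), v (Suc m - Suc i)}) ` {1..<m} = (\<lambda>i. {v i, v (Suc i)}) ` {1..<m}"
  proof (intro equalityI subsetI)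
    fix e assume "e \<in> (\<lambda>i. {v (Suc m - i), v (Suc m - Suc i)}) ` {1..<m}"
    then obtain i where "i \<in> {1..<m}" "e = {v (Suc m - i), v (Suc m - Suc i)}" by blast
    then show "e \<in> (\<lambda>i. {v i, v (Suc i)}) ` {1..<m}"
      by (intro image_eqI[where x = "m - i"]) (auto simp: insert_commute Suc_diff_le)
  next
    fix e assume "e \<in> (\<lambda>i. {v i, v (Suc i)}) ` {1..<m}"
    then obtain i where "i \<in> {1..<m}" "e = {v i, v (Suc i)}" by blast
    then show "e \<in> (\<lambda>i. {v (Suc m - i), v (Suc m - Suc i)}) ` {1..<m}"
      by (intro image_eqI[where x = "m - i"]) (auto simp: insert_commute Suc_diff_le)
  qed
  moreover have "(\<lambda>x. {v (Suc m - (Suc m - p x)), x}) ` X = (\<lambda>x. {v (p x), x}) ` X"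
  proof (rule image_cong[OF refl])
    fix x assume "x \<in> X"
    then have "Suc m - (Suc m - p x) = p x" using p_mem[of x] by auto
    then show "{v (Suc m - (Suc m - p x)), x} = {v (p x), x}" by simp
  qed
  ultimately show "edges G = (\<lambda>i. {v (Suc m - i), v (Suc m - Suc i)}) ` {1..<m}
      \<union> (\<lambda>x. {v (Suc m - (Suc m - p x)), x}) ` X"
    using edges_eq by simp
qed (use m2 finite_X in auto)

lemma image_caterpillar:
  assumes "inj_on h (verts G)"
  shows "caterpillar \<lparr>verts = h ` verts G, edges = (`) h ` edges G\<rparr> m (h \<circ> v) (h ` X) (p \<circ> inv_into X h)"
proof
  have injX: "inj_on h X" by (rule inj_on_subset[OF assms]) (simp add: verts_eq)
  have injv: "inj_on h (v ` {1..m})" by (rule inj_on_subset[OF assms]) (simp add: verts_eq)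
  show "inj_on (h \<circ> v) {1..m}" by (rule comp_inj_on[OF inj injv])
  have "h ` (v ` {1..m} \<inter> X) = h ` v ` {1..m} \<inter> h ` X"
    by (rule inj_on_image_Int[OF assms]) (auto simp: verts_eq)
  then show "(h \<circ> v) ` {1..m} \<inter> h ` X = {}" using disj by (simp add: image_comp)
  show "(p \<circ> inv_into X h) x \<in> {2..m - 1}" if "x \<in> h ` X" for x
    using that p_inner[of "inv_into X h x"] inv_into_into[of x h X] by simp
  have "(\<lambda>x. {(h \<circ> v) ((p \<circ> inv_into X h) x), x}) ` (h ` X) = (`) h ` (\<lambda>x. {v (p x), x}) ` X"
    unfolding image_image by (rule image_cong[OF refl]) (simp add: inv_into_f_f[OF injX])
  then show "edges \<lparr>verts = h ` verts G, edges = (`) h ` edges G\<rparr> =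
      (\<lambda>i. {(h \<circ> v) i, (h \<circ> v) (Suc i)}) ` {1..<m}
      \<union> (\<lambda>x. {(h \<circ> v) ((p \<circ> inv_into X h) x), x}) ` (h ` X)"
    by (simp add: edges_eq image_Un image_image)
qed (use m2 finite_X in \<open>auto simp: verts_eq\<close>)

end

text \<open>Match the spines position by position and glue arbitrary bijections between the sets of
  pendent vertices at equal positions. Thus the multiplicities of the positions determine the
  caterpillar.\<close>

lemma caterpillar_isomorphic:
  assumes "caterpillar G m v X p" "caterpillar H m u Y r"
    and fibres: "\<And>i. card {x \<in> X. p x = i} = card {y \<in> Y. r y = i}"
  shows "isomorphic G H"
proof -
  interpret G: caterpillar G m v X p by fact
  interpret H: caterpillar H m u Y r by fact
  have "\<exists>g. bij_betw g {x \<in> X. p x = i} {y \<in> Y. r y = i}" for i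
    by (rule finite_same_card_bij) (use G.finite_X H.finite_X fibres in auto)
  then obtain g where g: "\<And>i. bij_betw (g i) {x \<in> X. p x = i} {y \<in> Y. r y = i}" by metis
  define f where "f x = (if x \<in> X then g (p x) x else u (inv_into {1..m} v x))" for x
  have fv: "f (v i) = u i" if "i \<in> {1..m}" for i
    using inv_into_f_f[OF G.inj that] G.v_neq[OF that, of "v i"] by (auto simp: f_def)
  have fx: "f x \<in> Y" "r (f x) = p x" if "x \<in> X" for x
    using bij_betwE[OF g[of "p x"]] that by (auto simp: f_def)
  have "bij_betw f X Y"
    unfolding bij_betw_def
  proof
    show "inj_on f X"
    proof (rule inj_onI)
      fix x y assume xy: "x \<in> X" "y \<in> X" "f x = f y"
      then have "p x = p y" using fx by metis
      then show "x = y" using xy bij_betw_imp_inj_on[OF g[of "p x"]]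
        by (auto simp: f_def dest: inj_onD)
    qed
    show "f ` X = Y"
    proof (intro equalityI subsetI)
      fix y assume y: "y \<in> Y"
      then have "y \<in> g (r y) ` {x \<in> X. p x = r y}" using bij_betw_imp_surj_on[OF g[of "r y"]] by auto
      then show "y \<in> f ` X" by (auto simp: f_def intro!: image_eqI)
    qed (use fx in auto)
  qed
  moreover have "bij_betw f (v ` {1..m}) (u ` {1..m})"
    unfolding bij_betw_def
  proof
    show "inj_on f (v ` {1..m})"
      by (rule inj_onI) (use fv H.v_eq_iff in auto)
    show "f ` v ` {1..m} = u ` {1..m}" unfolding image_image by (rule image_cong[OF refl fv])
  qed
  ultimately have "bij_betw f (verts G) (verts H)"
    unfolding G.verts_eq H.verts_eq using H.disj by (intro bij_betw_combine)
  moreover have "adj G a b \<longleftrightarrow> adj H (f a) (f b)" if "a \<in> verts G" "b \<in> verts G" for a b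
    using that(1)
  proof (cases rule: G.verts_cases)
    case a: (1 i)
    show ?thesis using that(2)
    proof (cases rule: G.verts_cases)
      case (1 j)
      then show ?thesis using a fv G.adj_vv[of i j] H.adj_vv[of i j] by simp
    next
      case 2
      then show ?thesis using a fv fx[OF 2] G.adj_vx[OF a(1) 2] H.adj_vx[OF a(1) fx(1)[OF 2]] by simp
    qed
  next
    case a: 2
    show ?thesis using that(2)
    proof (cases rule: G.verts_cases)
      case (1 j)
      then have "adj G b a \<longleftrightarrow> adj H (f b) (f a)"
        using a fv fx[OF a] G.adj_vx[OF 1(1) a] H.adj_vx[OF 1(1) fx(1)[OF a]] by simp
      then show ?thesis by (simp only: adj_commute[of _ a] adj_commute[of _ "f a"])
    next
      case 2
      then show ?thesis using G.not_adj_xx[OF a 2] H.not_adj_xx[OF fx(1)[OF a] fx(1)[OF 2]] by simp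
    qed
  qed
  ultimately show ?thesis unfolding isomorphic_def by blast
qed

text \<open>Attachment to the path is the only thing to be assumed: acyclicity already makes the
  attachment point unique, forbids chords, and forbids edges between two attached vertices.\<close>

lemma (in longest_path) caterpillar:
  assumes "2 \<le> m" and att: "\<And>y. y \<in> off \<Longrightarrow> p y \<in> {1..m} \<and> adj G (v (p y)) y"
  shows "caterpillar G m v off p"
proof
  have att': "adj G y (v (p y))" if "y \<in> off" for y
    using att[OF that] by (simp only: adj_commute)
  show "p y \<in> {2..m - 1}" if "y \<in> off" for y
    using attach_inner[OF that] att[OF that] att'[OF that] by blast
  have edge: "{a, b} \<in> (\<lambda>i. {v i, v (Suc i)}) ` {1..<m} \<union> (\<lambda>x. {v (p x), x}) ` off"
    if ab: "adj G a b" and "a \<in> v ` {1..m}" for a b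
  proof -
    from that(2) obtain i where i: "i \<in> {1..m}" "a = v i" by blast
    have b: "b \<in> verts G" using adj_simpleD[OF G(1) that(1)] by blast
    show ?thesis
    proof (cases "b \<in> off")
      case True
      have "adj G b (v i)" using that(1) i(2) by (simp only: adj_commute)
      then have "p b = i" using attach_unique[OF True] att[OF True] att'[OF True] i(1) by blast
      then show ?thesis using i True by blast
    next
      case False
      then obtain j where j: "j \<in> {1..m}" "b = v j" using b by (auto simp: off_def)
      then have "j = Suc i \<or> i = Suc j" using chord that(1) i by blast
      then show ?thesis using i j by (auto simp: insert_commute)
    qed
  qed
  show "edges G = (\<lambda>i. {v i, v (Suc i)}) ` {1..<m} \<union> (\<lambda>x. {v (p x), x}) ` off"
  proof (intro equalityI subsetI)
    fix e assume "e \<in> edges G"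
    from edge_adjE[OF G(1) this] obtain a b where ab: "e = {a, b}" "adj G a b" .
    have ba: "adj G b a" using ab(2) by (simp only: adj_commute)
    have "a \<in> v ` {1..m} \<or> b \<in> v ` {1..m}"
    proof (rule ccontr)
      assume "\<not> (a \<in> v ` {1..m} \<or> b \<in> v ` {1..m})"
      then have "a \<in> off" "b \<in> off" using adj_simpleD[OF G(1) ab(2)] by (auto simp: off_def)
      then show False using attach_not_adj[of a b "p a" "p b"] att att' ab(2) by blast
    qed
    then show "e \<in> (\<lambda>i. {v i, v (Suc i)}) ` {1..<m} \<union> (\<lambda>x. {v (p x), x}) ` off"
      using edge[OF ab(2)] edge[OF ba] ab(1) by (metis insert_commute)
  next
    fix e assume "e \<in> (\<lambda>i. {v i, v (Suc i)}) ` {1..<m} \<union> (\<lambda>x. {v (p x), x}) ` off"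
    then show "e \<in> edges G" using step att by (auto simp: adj_def)
  qed
  show "verts G = v ` {1..m} \<union> off" using path_verts by (auto simp: off_def)
qed (use assms inj in \<open>auto simp: off_def G\<close>)

section \<open>Sums\<close>

text \<open>Half the sum of the numbers |2i - k - 1| over i from 1 to k, and also the sum of the
  first k + 1 terms of 0, 0, 1, 1, 2, 2, ...; both roles occur below.\<close>

definition quarter_sq :: "nat \<Rightarrow> nat" where
  "quarter_sq k = k\<^sup>2 div 4"

lemma quarter_sq_double: "quarter_sq (2 * k) = k\<^sup>2"
  by (simp add: quarter_sq_def power2_eq_square)

lemma quarter_sq_double_Suc: "quarter_sq (Suc (2 * k)) = k\<^sup>2 + k"
proof -
  have "(Suc (2 * k))\<^sup>2 = 1 + 4 * (k\<^sup>2 + k)" by (simp add: power2_eq_square algebra_simps)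
  then show ?thesis by (simp add: quarter_sq_def)
qed

lemma quarter_sq_Suc: "quarter_sq (Suc k) = quarter_sq k + Suc k div 2"
proof (cases "even k")
  case True
  then obtain b where "k = 2 * b" by blast
  then show ?thesis by (simp add: quarter_sq_double quarter_sq_double_Suc)
next
  case False
  then obtain b where b: "k = Suc (2 * b)" by (auto elim: oddE)
  have "quarter_sq (Suc k) = (Suc b)\<^sup>2" using b quarter_sq_double[of "Suc b"] by simp
  then show ?thesis using b by (simp add: quarter_sq_double_Suc power2_eq_square)
qed

lemma quarter_sq_mono: "j \<le> k \<Longrightarrow> quarter_sq j \<le> quarter_sq k"
  by (simp add: quarter_sq_def div_le_mono power_mono)

lemma quarter_sq_0 [simp]: "quarter_sq 0 = 0"
  by (simp add: quarter_sq_def)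

lemma quarter_sq_Suc_Suc: "quarter_sq (Suc (Suc k)) = quarter_sq k + Suc k"
proof -
  have "Suc k div 2 + Suc (Suc k) div 2 = Suc k" by presburger
  then show ?thesis by (simp add: quarter_sq_Suc)
qed

lemma quarter_sq_Suc_pred: "quarter_sq (Suc k) = quarter_sq (k - 1) + k"
  by (cases k) (simp_all add: quarter_sq_Suc_Suc, simp add: quarter_sq_def)

lemma sum_abs_centred: "(\<Sum>i=1..m. \<bar>2 * int i - int m - 1\<bar>) = 2 * int (quarter_sq m)"
proof (induction m rule: induct_nat_012)
  case (ge2 m)
  have "(\<Sum>i=1..Suc (Suc m). \<bar>2 * int i - int (Suc (Suc m)) - 1\<bar>) =
      (\<Sum>i=Suc 0..Suc m. \<bar>2 * int i - int m - 3\<bar>) + (int m + 1)"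
    by (simp add: sum.cl_ivl_Suc)
  also have "(\<Sum>i=Suc 0..Suc m. \<bar>2 * int i - int m - 3\<bar>) = (\<Sum>i=0..m. \<bar>2 * int i - int m - 1\<bar>)"
    unfolding sum.shift_bounds_cl_Suc_ivl by (rule sum.cong) auto
  also have "\<dots> = (int m + 1) + (\<Sum>i=1..m. \<bar>2 * int i - int m - 1\<bar>)"
    by (subst sum.atLeast_Suc_atMost) auto
  finally show ?case using ge2(1) by (simp add: quarter_sq_Suc_Suc)
qed (simp_all add: quarter_sq_def)

text \<open>At most two points of the interval have a given distance to its nearer end. The
  induction strips the two ends: at most two points vanish, and each remaining point contributes one
  less in the smaller interval.\<close>

lemma sum_min_ends:
  fixes Q :: "int set"
  assumes "Q \<subseteq> {a..b}"
  shows "int (quarter_sq (card Q - 1)) \<le> (\<Sum>i\<in>Q. min (i - a) (b - i))"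
  using assms
proof (induction "nat (b - a + 1)" arbitrary: Q a b rule: less_induct)
  case less
  show ?case
  proof (cases "Q = {}")
    case False
    then have "a \<le> b" using less.prems by fastforce
    have fin: "finite Q" using less.prems finite_subset by blast
    define Q' where "Q' = Q - {a, b}"
    have sub: "Q' \<subseteq> {a + 1..b - 1}" using less.prems by (auto simp: Q'_def)
    have "card Q - card {a, b} \<le> card Q'" unfolding Q'_def by (rule diff_card_le_card_Diff) simp
    moreover have "card {a, b} \<le> 2" by (simp add: card_insert_if)
    ultimately have "card Q - 1 \<le> Suc (card Q')" by linarith
    then have "quarter_sq (card Q - 1) \<le> quarter_sq (card Q' - 1) + card Q'"
      using quarter_sq_mono quarter_sq_Suc_pred by metis
    moreover have "int (quarter_sq (card Q' - 1)) \<le> (\<Sum>i\<in>Q'. min (i - (a + 1)) (b - 1 - i))"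
      by (rule less.hyps) (use sub \<open>a \<le> b\<close> in auto)
    moreover have "(\<Sum>i\<in>Q. min (i - a) (b - i)) = (\<Sum>i\<in>Q'. min (i - a) (b - i))"
      by (rule sum.mono_neutral_right) (use fin less.prems in \<open>auto simp: Q'_def\<close>)
    moreover have "(\<Sum>i\<in>Q'. min (i - a) (b - i)) = (\<Sum>i\<in>Q'. min (i - (a + 1)) (b - 1 - i) + 1)"
      by (rule sum.cong) auto
    moreover have "\<dots> = (\<Sum>i\<in>Q'. min (i - (a + 1)) (b - 1 - i)) + int (card Q')"
      by (simp add: sum.distrib)
    ultimately show ?thesis by linarith
  qed simp
qed

text \<open>For the tree with diameter path on \<open>m\<close> vertices, \<open>q\<close> of which carry branches, this bounds
  twice the sum of the sizes of the smaller sides of all edges.\<close>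

definition twice_sides_bound :: "nat \<Rightarrow> nat \<Rightarrow> nat \<Rightarrow> int" where
  "twice_sides_bound n m q =
     2 * int (quarter_sq m) + (int n - int m) * (int m - 1) - 2 * int (quarter_sq (q - 1))"

text \<open>Growth of the bound when the path gains one vertex, with \<open>m - 2 - t\<close> as the
  least number of branching positions for \<open>t\<close> vertices of degree two. The two quarter
  squares grow by \<open>Suc m div 2\<close> and \<open>q div 2\<close>, and both roundings favour
  the inequality.\<close>

lemma twice_sides_bound_step:
  "twice_sides_bound n (Suc m) (Suc m - 2 - t) - twice_sides_bound n m (m - 2 - t)
     \<ge> int n - int m - int (m - 2 - t)"
proof -
  define q where "q = m - 2 - t"
  define a where "a = int (quarter_sq (Suc m - 2 - t - 1))"
  define b where "b = int (quarter_sq (q - 1))"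
  define d where "d = twice_sides_bound n (Suc m) (Suc m - 2 - t) - twice_sides_bound n m q"
  have "quarter_sq (Suc m - 2 - t - 1) = quarter_sq (q - 1) + q div 2"
  \<comment> \<open>For a path shorter than \<open>t + 2\<close> the subtractions truncate and both
    arguments of \<open>quarter_sq\<close> are 0.\<close>
  proof (cases "t + 2 \<le> m")
    case True
    then have "Suc m - 2 - t - 1 = q" by (simp add: q_def)
    then show ?thesis by (cases q) (simp_all add: quarter_sq_Suc)
  next
    case False
    then have "q = 0" "Suc m - 2 - t - 1 = 0" by (auto simp: q_def)
    then show ?thesis by simp
  qed
  define x y where "x = int (Suc m div 2)" and "y = int (q div 2)"
  have "a = b + y" using \<open>quarter_sq (Suc m - 2 - t - 1) = _\<close> by (simp add: a_def b_def y_def)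
  moreover have "2 * x \<ge> int m" unfolding x_def by presburger
  moreover have "2 * y \<le> int q" unfolding y_def by presburger
  moreover have "d = 2 * x + int n - 2 * int m - 2 * (a - b)"
    unfolding x_def d_def a_def b_def twice_sides_bound_def q_def by (simp add: quarter_sq_Suc algebra_simps)
  ultimately have "d = int n - int m - int q + (2 * x - int m) + (int q - 2 * y)" by simp
  then have "d \<ge> int n - int m - int q"
    using \<open>2 * x \<ge> int m\<close> \<open>2 * y \<le> int q\<close> by simp
  then show ?thesis by (simp only: d_def q_def)
qed

text \<open>At \<open>m = M - 1\<close> the step estimate is exactly \<open>2 + \<epsilon>\<close>,
  and it only grows for smaller \<open>m\<close>. A larger \<open>q\<close> merely lowers the bound,
  so the least \<open>q\<close> is the one to compare with.\<close>

lemma twice_sides_bound_less: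
  assumes "m < M" "M = t + p + 2" "n = M + p + \<epsilon>" "1 \<le> p" "m \<le> q + t + 2" "\<epsilon> \<le> 1"
  shows "twice_sides_bound n m q + 2 + int \<epsilon> \<le> twice_sides_bound n M p"
proof -
  let ?H = "\<lambda>m. twice_sides_bound n m (m - 2 - t)"
  have step: "?H m + 2 + int \<epsilon> \<le> ?H (Suc m)" if "m < M" for m
  proof -
    have "int n - int m - int (m - 2 - t) \<ge> 2 + int \<epsilon>" using that assms by linarith
    then show ?thesis using twice_sides_bound_step[of n m t] by linarith
  qed
  have mono: "?H m \<le> ?H M'" if "m \<le> M'" "M' \<le> M" for m M'
    using that
  proof (induction M' rule: dec_induct)
    case (step k)
    then show ?case using \<open>\<And>m. m < M \<Longrightarrow> ?H m + 2 + int \<epsilon> \<le> ?H (Suc m)\<close>[of k] by simp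
  qed simp
  have "m - 2 - t - 1 \<le> q - 1" using assms by linarith
  then have "twice_sides_bound n m q \<le> ?H m"
    using quarter_sq_mono by (simp add: twice_sides_bound_def)
  moreover have "?H (Suc m) \<le> ?H M" by (rule mono) (use assms(1) in simp_all)
  moreover have "M - 2 - t = p" using assms by simp
  ultimately show ?thesis using step[OF assms(1)] by simp
qed

text \<open>Raising the cap from \<open>p\<close> to \<open>Suc p\<close> adds one for each
  \<open>i\<close> with \<open>2 * i - 2\<close> above \<open>p\<close>; the number of these
  \<open>i\<close> is \<open>h\<close> minus the increment of \<open>quarter_sq\<close>.\<close>

lemma sum_min_double:
  assumes "p \<le> 2 * h"
  shows "(\<Sum>i=1..h. int (min (2 * i - 2) p)) = int h * int p - int (quarter_sq (Suc p))"
  using assms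
proof (induction p)
  case 0
  then show ?case by (simp add: quarter_sq_def)
next
  case (Suc p)
  have "(\<Sum>i=1..h. int (min (2 * i - 2) (Suc p))) =
      (\<Sum>i=1..h. int (min (2 * i - 2) p) + (if Suc p \<le> 2 * i - 2 then 1 else 0))"
    by (rule sum.cong) auto
  also have "\<dots> = (\<Sum>i=1..h. int (min (2 * i - 2) p)) + int (card {i \<in> {1..h}. Suc p \<le> 2 * i - 2})"
    by (simp add: sum.distrib sum.inter_filter[symmetric])
  also have "{i \<in> {1..h}. Suc p \<le> 2 * i - 2} = {Suc (Suc (Suc p) div 2)..h}" by auto
  finally have "(\<Sum>i=1..h. int (min (2 * i - 2) (Suc p))) =
      int h * int p - int (quarter_sq (Suc p)) + (int h - int (Suc (Suc p) div 2))"
    using Suc by (simp add: of_nat_diff)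
  moreover have "int (quarter_sq (Suc (Suc p))) = int (quarter_sq (Suc p)) + int (Suc (Suc p) div 2)"
    using quarter_sq_Suc[of "Suc p"] by simp
  ultimately show ?case by (simp add: algebra_simps)
qed

text \<open>Mirror pairs of spine edges; for even \<open>m\<close> the middle edge is its own mirror
  image.\<close>

lemma sum_pair_ends:
  fixes f :: "nat \<Rightarrow> int"
  shows "(\<Sum>i=1..<m. f i) = (\<Sum>i=1..(m - 1) div 2. f i + f (m - i))
     + (if even m \<and> 0 < m then f (m div 2) else 0)"
proof -
  let ?h = "(m - 1) div 2"
  let ?A = "{1..?h}" and ?B = "(\<lambda>i. m - i) ` {1..?h}" and ?C = "if even m \<and> 0 < m then {m div 2} else {}"
  have "{1..<m} = ?A \<union> ?B \<union> ?C"
  proof (intro equalityI subsetI)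
    fix i assume i: "i \<in> {1..<m}"
    show "i \<in> ?A \<union> ?B \<union> ?C"
    proof (cases "2 * i < m \<or> 2 * i = m")
      case False
      then have "i \<in> ?B" using i by (intro image_eqI[where x = "m - i"]) auto
      then show ?thesis by blast
    qed (use i in auto)
  qed (auto split: if_splits)
  moreover have "(\<Sum>i\<in>?A \<union> ?B \<union> ?C. f i) = (\<Sum>i\<in>?A \<union> ?B. f i) + (\<Sum>i\<in>?C. f i)"
    by (rule sum.union_disjoint) (auto split: if_splits)
  moreover have "(\<Sum>i\<in>?A \<union> ?B. f i) = (\<Sum>i\<in>?A. f i) + (\<Sum>i\<in>?B. f i)"
    by (rule sum.union_disjoint) auto
  moreover have "inj_on (\<lambda>i. m - i) {1..?h}" by (rule inj_onI) auto
  then have "(\<Sum>i\<in>?B. f i) = (\<Sum>i\<in>?A. f (m - i))" by (simp add: sum.reindex)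
  ultimately show ?thesis by (simp add: sum.distrib)
qed

text \<open>The largest possible number of pendent vertices attached to the \<open>i\<close> outermost spine vertices
  on either side, if \<open>p\<close> spine vertices carry one pendent vertex each and one of them carries
  \<open>\<epsilon>\<close> more.\<close>

definition max_outer :: "nat \<Rightarrow> nat \<Rightarrow> nat \<Rightarrow> nat" where
  "max_outer p \<epsilon> i = min (2 * i - 2) p + (if 2 \<le> i then \<epsilon> else 0)"

text \<open>Lower bound for a caterpillar with \<open>p + \<epsilon>\<close> pendent vertices:
  mirror pairs with absolute values dropped and the outer counts maximal, the middle edge with an
  imbalance of the parity of \<open>n\<close>, and \<open>n - 2\<close> for each pendent
  edge.\<close>

definition min_mostar :: "nat \<Rightarrow> nat \<Rightarrow> nat \<Rightarrow> int" where
  "min_mostar m p \<epsilon> = (let n = int (m + p + \<epsilon>) in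
     (\<Sum>i=1..(m - 1) div 2. 2 * (n - 2 * int i - int (max_outer p \<epsilon> i)))
     + (if even m then n mod 2 else 0) + int (p + \<epsilon>) * (n - 2))"

text \<open>The link between both lower bounds: at the optimal path length the one for all trees and
  the one for caterpillars agree up to the parity term of the middle edge. This makes caterpillars
  comparable with trees of shorter longest path.\<close>

lemma min_mostar_eq:
  assumes "p + 2 \<le> m" "1 \<le> p" "n = m + p + \<epsilon>"
  shows "min_mostar m p \<epsilon> = int n * (int n - 1) - twice_sides_bound n m p + (if even m then int n mod 2 else 0)"
proof -
  define h where "h = (m - 1) div 2"
  have h: "1 \<le> h" "p \<le> 2 * h" using assms unfolding h_def by linarith+
  have "(\<Sum>i=1..h. int (max_outer p \<epsilon> i)) = (\<Sum>i=1..h. int (min (2 * i - 2) p)) + (\<Sum>i=1..h. if 2 \<le> i then int \<epsilon> else 0)"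
    by (simp add: max_outer_def sum.distrib if_distrib[of int] cong: if_cong)
  also have "(\<Sum>i=1..h. if 2 \<le> i then int \<epsilon> else 0) = int (card {i \<in> {1..h}. 2 \<le> i}) * int \<epsilon>"
    by (simp add: sum.inter_filter[symmetric])
  also have "{i \<in> {1..h}. 2 \<le> i} = {2..h}" by auto
  finally have mo: "(\<Sum>i=1..h. int (max_outer p \<epsilon> i)) =
      int h * int p - (int (quarter_sq (p - 1)) + int p) + (int h - 1) * int \<epsilon>"
    using sum_min_double[OF h(2)] h quarter_sq_Suc_pred[of p] by (simp add: of_nat_diff)
  have gauss: "2 * (\<Sum>i=1..h. int i) = int h * (int h + 1)"
    by (induction h) (auto simp: algebra_simps)
  have "(\<Sum>i=1..h. 2 * (int n - 2 * int i - int (max_outer p \<epsilon> i))) =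
      2 * int h * int n - 2 * (2 * (\<Sum>i=1..h. int i)) - 2 * (\<Sum>i=1..h. int (max_outer p \<epsilon> i))"
    by (simp add: sum_subtractf sum_distrib_left[symmetric] sum.distrib right_diff_distrib)
  then have s: "(\<Sum>i=1..h. 2 * (int n - 2 * int i - int (max_outer p \<epsilon> i))) =
      2 * int h * int n - 2 * (int h * (int h + 1))
      - 2 * (int h * int p - (int (quarter_sq (p - 1)) + int p) + (int h - 1) * int \<epsilon>)"
    by (simp only: gauss mo)
  have n: "int n = int m + int p + int \<epsilon>" using assms by simp
  have key: "2 * int h * int n - 2 * (int h * (int h + 1))
      - 2 * (int h * int p - (int (quarter_sq (p - 1)) + int p) + (int h - 1) * int \<epsilon>)
      + (int p + int \<epsilon>) * (int n - 2)
      = int n * (int n - 1) - twice_sides_bound n m p"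
  proof (cases "even m")
    case True
    then have m: "m = 2 * Suc h" using assms by (auto simp: h_def elim!: evenE)
    have sq: "quarter_sq m = (Suc h)\<^sup>2" unfolding m by (rule quarter_sq_double)
    show ?thesis unfolding twice_sides_bound_def sq unfolding n m
      by (simp add: algebra_simps power2_eq_square)
  next
    case False
    then have m: "m = Suc (2 * h)" using assms by (auto simp: h_def elim!: oddE)
    have sq: "quarter_sq m = h\<^sup>2 + h" unfolding m by (rule quarter_sq_double_Suc)
    show ?thesis unfolding twice_sides_bound_def sq unfolding n m
      by (simp add: algebra_simps power2_eq_square)
  qed
  show ?thesis unfolding min_mostar_def Let_def assms(3)[symmetric] h_def[symmetric] s
    using key by simp
qed

section \<open>The Mostar index of caterpillars\<close>

text \<open>For a mirror pair, \<open>x\<close> and \<open>y\<close> are its signed imbalances.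
  Equality means that the outer counts are maximal and that neither outer part holds more than half
  of the vertices.\<close>

lemma abs_add_slack:
  fixes x y s :: int
  assumes "s \<le> x + y"
  shows "0 \<le> \<bar>x\<bar> + \<bar>y\<bar> - s" and "\<bar>x\<bar> + \<bar>y\<bar> - s \<le> 0 \<Longrightarrow> s = x + y \<and> 0 \<le> x \<and> 0 \<le> y"
  using assms by (auto simp: abs_if split: if_splits)

context caterpillar
begin

definition pend_gt :: "nat \<Rightarrow> nat" where
  "pend_gt i = card {x \<in> X. m - i < p x}"

definition half :: nat where "half = (m - 1) div 2"

definition order :: int where "order = int m + int (card X)"

lemma half: "i \<in> {1..half} \<Longrightarrow> 1 \<le> i \<and> 2 * i < m"
  by (auto simp: half_def)

lemma pend_le_compl: "pend_le (m - i) + pend_gt i = card X"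
proof -
  have "X = {x \<in> X. p x \<le> m - i} \<union> {x \<in> X. m - i < p x}" by auto
  then have "card X = card ({x \<in> X. p x \<le> m - i} \<union> {x \<in> X. m - i < p x})" by simp
  also have "\<dots> = pend_le (m - i) + pend_gt i"
    unfolding pend_le_def pend_gt_def by (rule card_Un_disjoint) (use finite_X in auto)
  finally show ?thesis by simp
qed

lemma mostar_pairs:
  "mostar G = (\<Sum>i=1..half. \<bar>order - 2 * (int i + int (pend_le i))\<bar> + \<bar>order - 2 * (int i + int (pend_gt i))\<bar>)
     + (if even m then \<bar>order - 2 * (int (m div 2) + int (pend_le (m div 2)))\<bar> else 0)
     + int (card X) * (order - 2)"
proof -
  let ?f = "\<lambda>i. \<bar>order - 2 * (int i + int (pend_le i))\<bar>"
  \<comment> \<open>Seen from the right end, edge \<open>m - i\<close> cuts off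
    \<open>i + pend_gt i\<close> vertices; passing to the complement only changes the sign inside
    the absolute value.\<close>
  have "?f (m - i) = \<bar>order - 2 * (int i + int (pend_gt i))\<bar>" if "i \<in> {1..half}" for i
  proof -
    have "int (m - i) = int m - int i" using half[OF that] by simp
    moreover have "int (pend_le (m - i)) = int (card X) - int (pend_gt i)"
      using pend_le_compl[of i] by linarith
    ultimately show ?thesis by (simp add: order_def)
  qed
  then have "(\<Sum>i=1..half. ?f i + ?f (m - i)) =
      (\<Sum>i=1..half. ?f i + \<bar>order - 2 * (int i + int (pend_gt i))\<bar>)"
    by (intro sum.cong) auto
  then have "(\<Sum>i=1..<m. ?f i) = (\<Sum>i=1..half. ?f i + \<bar>order - 2 * (int i + int (pend_gt i))\<bar>)
      + (if even m then ?f (m div 2) else 0)"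
    using sum_pair_ends[of ?f m] m2 by (simp add: half_def)
  moreover have "int (card (verts G)) = order" by (simp add: card_verts order_def)
  ultimately show ?thesis using mostar_eq by simp
qed

end

text \<open>\<open>Y\<close> has one pendent vertex for every spine position that carries pendent vertices; \<open>E\<close>
  is empty or holds a second pendent vertex of one of these positions.\<close>

locale two_layer = caterpillar +
  fixes Y E
  assumes X_eq: "X = Y \<union> E" and YE: "Y \<inter> E = {}" and inj_Y: "inj_on p Y"
    and E_pos: "p ` E \<subseteq> p ` Y" and card_E: "card E \<le> 1"
begin

lemma finite_YE: "finite Y" "finite E"
  using finite_X X_eq by auto

lemma card_X: "card X = card Y + card E"
  unfolding X_eq by (rule card_Un_disjoint) (use finite_YE YE in auto)

lemma card_pos: "card (p ` Y) = card Y"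
  by (rule card_image[OF inj_Y])

lemma pos_subset: "p ` Y \<subseteq> {2..m - 1}"
  using p_inner X_eq by auto

lemma card_Y_le: "card Y \<le> m - 2"
  using card_mono[OF _ pos_subset] card_pos by simp

lemma card_split:
  "card {x \<in> X. P (p x)} = card {i \<in> p ` Y. P i} + card {x \<in> E. P (p x)}"
proof -
  have "card {x \<in> X. P (p x)} = card ({x \<in> Y. P (p x)} \<union> {x \<in> E. P (p x)})"
    by (rule arg_cong[where f = card]) (auto simp: X_eq)
  also have "\<dots> = card {x \<in> Y. P (p x)} + card {x \<in> E. P (p x)}"
    by (rule card_Un_disjoint) (use finite_YE YE in auto)
  also have "card {x \<in> Y. P (p x)} = card (p ` {x \<in> Y. P (p x)})"
    by (rule card_image[symmetric], rule inj_on_subset[OF inj_Y]) auto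
  also have "p ` {x \<in> Y. P (p x)} = {i \<in> p ` Y. P i}" by auto
  finally show ?thesis .
qed

section \<open>Outer counts and slack\<close>

text \<open>The \<open>i\<close> outermost spine vertices on both sides include the two ends of the
  spine, which carry nothing; this is the 2 in \<open>2 * i - 2\<close>.\<close>

lemma card_outer_pos:
  assumes "i \<in> {1..half}"
  shows "card {j \<in> p ` Y. j \<le> i} + card {j \<in> p ` Y. m - i < j} \<le> min (2 * i - 2) (card Y)"
proof -
  have "card {j \<in> p ` Y. j \<le> i} + card {j \<in> p ` Y. m - i < j} =
      card ({j \<in> p ` Y. j \<le> i} \<union> {j \<in> p ` Y. m - i < j})"
    by (rule card_Un_disjoint[symmetric]) (use finite_YE half[OF assms] in auto)
  moreover have "\<dots> \<le> card (p ` Y)" by (rule card_mono) (use finite_YE in auto)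
  moreover have "card {j \<in> p ` Y. j \<le> i} \<le> card {2..i}"
    by (rule card_mono) (use pos_subset in auto)
  moreover have "card {j \<in> p ` Y. m - i < j} \<le> card {m - i + 1..m - 1}"
    by (rule card_mono) (use pos_subset in auto)
  ultimately show ?thesis using card_pos half[OF assms] by auto
qed

lemma card_outer_E:
  assumes "i \<in> {1..half}"
  shows "card {x \<in> E. p x \<le> i} + card {x \<in> E. m - i < p x} \<le> (if 2 \<le> i then card E else 0)"
proof -
  have "card {x \<in> E. p x \<le> i} + card {x \<in> E. m - i < p x} = card ({x \<in> E. p x \<le> i} \<union> {x \<in> E. m - i < p x})"
    by (rule card_Un_disjoint[symmetric]) (use finite_YE half[OF assms] in auto)
  moreover have "\<dots> \<le> card E" by (rule card_mono) (use finite_YE in auto)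
  moreover have "card ({x \<in> E. p x \<le> i} \<union> {x \<in> E. m - i < p x}) = 0" if "\<not> 2 \<le> i"
  proof -
    have "{x \<in> E. p x \<le> i} \<union> {x \<in> E. m - i < p x} = {}"
      using that half[OF assms] p_inner X_eq by force
    then show ?thesis by (simp only: card.empty)
  qed
  ultimately show ?thesis by simp
qed

lemma outer_le: "i \<in> {1..half} \<Longrightarrow> pend_le i + pend_gt i \<le> max_outer (card Y) (card E) i"
  unfolding pend_le_def pend_gt_def card_split[of "\<lambda>j. j \<le> _"] card_split[of "\<lambda>j. m - _ < j"] max_outer_def
  using card_outer_pos[of i] card_outer_E[of i] by linarith

text \<open>The excess of a mirror pair over its share in \<open>min_mostar\<close>. All slacks are
  nonnegative, so each one is bounded by the total excess and near-optimality constrains every pair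
  separately.\<close>

definition pair_slack :: "nat \<Rightarrow> int" where
  "pair_slack i = \<bar>order - 2 * (int i + int (pend_le i))\<bar> + \<bar>order - 2 * (int i + int (pend_gt i))\<bar>
     - 2 * (order - 2 * int i - int (max_outer (card Y) (card E) i))"

definition mid_slack :: int where
  "mid_slack = (if even m then \<bar>order - 2 * (int (m div 2) + int (pend_le (m div 2)))\<bar> - order mod 2 else 0)"

lemma mostar_slack: "mostar G = min_mostar m (card Y) (card E) + (\<Sum>i=1..half. pair_slack i) + mid_slack"
proof -
  have "order = int (m + card Y + card E)" by (simp add: order_def card_X)
  then show ?thesis unfolding mostar_pairs min_mostar_def pair_slack_def mid_slack_def half_def Let_def
    by (simp add: sum_subtractf card_X)
qed

lemma pair_slack_summands:
  assumes "i \<in> {1..half}"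
  shows "2 * (order - 2 * int i - int (max_outer (card Y) (card E) i))
    \<le> (order - 2 * (int i + int (pend_le i))) + (order - 2 * (int i + int (pend_gt i)))"
proof -
  have "int (pend_le i) + int (pend_gt i) \<le> int (max_outer (card Y) (card E) i)"
    using outer_le[OF assms] by linarith
  then show ?thesis by simp
qed

lemma pair_slack_nonneg: "i \<in> {1..half} \<Longrightarrow> 0 \<le> pair_slack i"
  unfolding pair_slack_def by (rule abs_add_slack(1)[OF pair_slack_summands])

lemma mid_slack_nonneg: "0 \<le> mid_slack"
proof -
  have "a mod 2 \<le> \<bar>a - 2 * b\<bar>" for a b :: int by presburger
  from this[of order "int (m div 2) + int (pend_le (m div 2))"] show ?thesis
    unfolding mid_slack_def by (simp only: split: if_split) simp
qed

lemma pair_slack_le: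
  assumes "i \<in> {1..half}"
  shows "pair_slack i \<le> mostar G - min_mostar m (card Y) (card E)"
proof -
  have "pair_slack i \<le> (\<Sum>i=1..half. pair_slack i)"
    by (rule member_le_sum) (use assms pair_slack_nonneg in auto)
  then show ?thesis using mostar_slack mid_slack_nonneg by linarith
qed

lemma mid_slack_le: "mid_slack \<le> mostar G - min_mostar m (card Y) (card E)"
  using sum_nonneg[of "{1..half}" pair_slack] pair_slack_nonneg mostar_slack by simp

lemma tight:
  assumes "mostar G \<le> min_mostar m (card Y) (card E)" "i \<in> {1..half}"
  shows "pend_le i + pend_gt i = max_outer (card Y) (card E) i"
    "2 * (i + pend_le i) \<le> m + card X" "2 * (i + pend_gt i) \<le> m + card X"
proof -
  have "pair_slack i \<le> 0" using pair_slack_le[OF assms(2)] assms(1) by linarith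
  note abs_add_slack(2)[OF pair_slack_summands[OF assms(2)] this[unfolded pair_slack_def]]
  then have h: "int (pend_le i) + int (pend_gt i) = int (max_outer (card Y) (card E) i)"
    "2 * (int i + int (pend_le i)) \<le> int m + int (card X)"
    "2 * (int i + int (pend_gt i)) \<le> int m + int (card X)"
    unfolding order_def by simp_all
  show "pend_le i + pend_gt i = max_outer (card Y) (card E) i" using h(1) by linarith
  have "int (2 * (i + pend_le i)) \<le> int (m + card X)" using h(2) by simp
  then show "2 * (i + pend_le i) \<le> m + card X" by (simp only: of_nat_le_iff)
  have "int (2 * (i + pend_gt i)) \<le> int (m + card X)" using h(3) by simp
  then show "2 * (i + pend_gt i) \<le> m + card X" by (simp only: of_nat_le_iff)
qed

text \<open>The maximal outer count is the sum of separate maxima for \<open>Y\<close> and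
  \<open>E\<close>; if the sum is attained, so is each of them.\<close>

lemma tight_pos:
  assumes "mostar G \<le> min_mostar m (card Y) (card E)" "i \<in> {1..half}"
  shows "card {j \<in> p ` Y. j \<le> i} + card {j \<in> p ` Y. m - i < j} = min (2 * i - 2) (card Y)"
    and "card {x \<in> E. p x \<le> i} + card {x \<in> E. m - i < p x} = (if 2 \<le> i then card E else 0)"
  using tight(1)[OF assms] card_outer_pos[OF assms(2)] card_outer_E[OF assms(2)]
  unfolding pend_le_def pend_gt_def card_split[of "\<lambda>j. j \<le> _"] card_split[of "\<lambda>j. m - _ < j"] max_outer_def
  by linarith+

lemma reflect_two_layer: "two_layer G m (\<lambda>i. v (Suc m - i)) X (\<lambda>x. Suc m - p x) Y E"
proof -
  interpret R: caterpillar G m "\<lambda>i. v (Suc m - i)" X "\<lambda>x. Suc m - p x" by (rule reflect)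
  show ?thesis
  proof
    show "inj_on (\<lambda>x. Suc m - p x) Y"
    proof (rule inj_onI)
      fix x y assume "x \<in> Y" "y \<in> Y" "Suc m - p x = Suc m - p y"
      then have "p x = p y" using p_mem[of x] p_mem[of y] X_eq by auto
      then show "x = y" using \<open>x \<in> Y\<close> \<open>y \<in> Y\<close> inj_Y by (auto dest: inj_onD)
    qed
    show "(\<lambda>x. Suc m - p x) ` E \<subseteq> (\<lambda>x. Suc m - p x) ` Y" using E_pos by fastforce
  qed (use X_eq YE card_E in auto)
qed

lemma reflect_pos:
  assumes "p ` Y = {2..\<alpha> + 1} \<union> {m - \<beta>..m - 1}" "\<alpha> + \<beta> + 2 \<le> m"
  shows "(\<lambda>x. Suc m - p x) ` Y = {2..\<beta> + 1} \<union> {m - \<alpha>..m - 1}"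
proof -
  have "(\<lambda>x. Suc m - p x) ` Y = (\<lambda>i. Suc m - i) ` (p ` Y)" by (simp add: image_image)
  also have "\<dots> = (\<lambda>i. Suc m - i) ` {2..\<alpha> + 1} \<union> (\<lambda>i. Suc m - i) ` {m - \<beta>..m - 1}"
    by (simp add: assms(1) image_Un)
  also have "(\<lambda>i. Suc m - i) ` {2..\<alpha> + 1} = {m - \<alpha>..m - 1}"
  proof (intro equalityI subsetI)
    fix j assume "j \<in> {m - \<alpha>..m - 1}"
    then show "j \<in> (\<lambda>i. Suc m - i) ` {2..\<alpha> + 1}"
      using assms(2) by (intro image_eqI[where x = "Suc m - j"]) auto
  qed (use assms(2) in auto)
  also have "(\<lambda>i. Suc m - i) ` {m - \<beta>..m - 1} = {2..\<beta> + 1}"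
  proof (intro equalityI subsetI)
    fix j assume "j \<in> {2..\<beta> + 1}"
    then show "j \<in> (\<lambda>i. Suc m - i) ` {m - \<beta>..m - 1}"
      using assms(2) by (intro image_eqI[where x = "Suc m - j"]) auto
  qed (use assms(2) in auto)
  finally show ?thesis by blast
qed

end

section \<open>Packing and balance of the pendent vertices\<close>

text \<open>With \<open>r = card Q div 2\<close>, maximality at \<open>i = r + 1\<close> fills all
  \<open>2 * r\<close> inner positions within the outer part. For odd \<open>card Q\<close> one
  position remains, and it must adjoin one of the two blocks.\<close>

lemma balanced_positions:
  fixes Q :: "nat set"
  assumes m: "2 \<le> m" and Q: "Q \<subseteq> {2..m - 1}"
    and outer: "\<And>i. 1 \<le> i \<Longrightarrow> 2 * i < m \<Longrightarrow>
      card {j \<in> Q. j \<le> i} + card {j \<in> Q. m - i < j} = min (2 * i - 2) (card Q)"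
  shows "\<exists>\<alpha> \<beta>. \<alpha> + \<beta> = card Q \<and> \<alpha> \<le> \<beta> + 1 \<and> \<beta> \<le> \<alpha> + 1 \<and> Q = {2..\<alpha> + 1} \<union> {m - \<beta>..m - 1}"
proof -
  have fin: "finite Q" using Q finite_subset by blast
  have cQ: "card Q \<le> m - 2" using card_mono[OF _ Q] by simp
  let ?O = "\<lambda>i. {2..i} \<union> {m - i + 1..m - 1}"
  have cO: "card (?O i) = 2 * i - 2" if "1 \<le> i" "2 * i < m" for i
    using that by (subst card_Un_disjoint) auto
  have cQO: "card (Q \<inter> ?O i) = min (2 * i - 2) (card Q)" if "1 \<le> i" "2 * i < m" for i
  proof -
    have "Q \<inter> ?O i = {j \<in> Q. j \<le> i} \<union> {j \<in> Q. m - i < j}" using Q by fastforce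
    moreover have "card \<dots> = card {j \<in> Q. j \<le> i} + card {j \<in> Q. m - i < j}"
      by (rule card_Un_disjoint) (use that fin in auto)
    ultimately show ?thesis using outer[OF that] by simp
  qed
  define r where "r = card Q div 2"
  show ?thesis
  \<comment> \<open>If \<open>r + 1\<close> is too large to index a mirror pair, then
    \<open>card Q\<close> has to be \<open>m - 2\<close> and all inner positions are
    occupied.\<close>
  proof (cases "2 * (r + 1) < m")
    case False
    then have "card Q = m - 2" "card Q = 2 * r" "m - 2 = 2 * r" using cQ by (auto simp: r_def)
    then have "Q = {2..m - 1}" using Q by (intro card_subset_eq) auto
    also have "\<dots> = {2..r + 1} \<union> {m - r..m - 1}" using \<open>m - 2 = 2 * r\<close> m by auto
    finally show ?thesis using \<open>card Q = 2 * r\<close> by (intro exI[of _ r]) auto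
  next
    case r: True
    have sub: "?O (r + 1) \<subseteq> Q"
    proof -
      have "card (Q \<inter> ?O (r + 1)) = card (?O (r + 1))"
        using cQO[of "r + 1"] cO[of "r + 1"] r by (simp add: r_def)
      then have "Q \<inter> ?O (r + 1) = ?O (r + 1)" by (intro card_subset_eq) auto
      then show ?thesis by blast
    qed
    have O: "?O (r + 1) = {2..r + 1} \<union> {m - r..m - 1}" using r by auto
    show ?thesis
    proof (cases "even (card Q)")
      case True
      then have "card (?O (r + 1)) = card Q" using cO[of "r + 1"] r by (simp add: r_def)
      then have "?O (r + 1) = Q" by (rule card_subset_eq[OF fin sub])
      then show ?thesis using O True by (intro exI[of _ r]) (auto simp: r_def)
    next
      case False
      then have c: "card Q = Suc (2 * r)" by (auto simp: r_def elim: oddE)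
      have "card (Q - ?O (r + 1)) = 1"
        using card_Diff_subset[OF _ sub] cO[of "r + 1"] r c by simp
      then obtain j where j: "Q - ?O (r + 1) = {j}" by (auto simp: card_1_singleton_iff)
      then have Qj: "Q = insert j ({2..r + 1} \<union> {m - r..m - 1})" using sub O by blast
      have jQ: "j \<in> {2..m - 1}" "j \<notin> ?O (r + 1)" using j Q by blast+
      have "j = r + 2 \<or> j = m - r - 1"
      \<comment> \<open>Maximality at \<open>i = r + 2\<close> traps \<open>j\<close> next to a
        block; if that index is too large, at most two free positions exist, and both are adjacent
        to a block.\<close>
      proof (cases "2 * (r + 2) < m")
        case True
        then have "card (Q \<inter> ?O (r + 2)) = card Q" using cQO[of "r + 2"] c by simp
        then have "Q \<inter> ?O (r + 2) = Q" by (intro card_subset_eq) (use fin in auto)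
        then have "j \<in> ?O (r + 2)" using j by blast
        then show ?thesis using jQ by auto
      next
        case False
        then show ?thesis using jQ r by auto
      qed
      then show ?thesis
      proof
        assume "j = r + 2"
        then have "Q = {2..(r + 1) + 1} \<union> {m - r..m - 1}" using Qj by auto
        then show ?thesis using c by (intro exI[of _ "r + 1"] exI[of _ r]) auto
      next
        assume j': "j = m - r - 1"
        have "{m - (r + 1)..m - 1} = insert j {m - r..m - 1}" using j' r by auto
        then have "Q = {2..r + 1} \<union> {m - (r + 1)..m - 1}" using Qj by auto
        then show ?thesis using c by (intro exI[of _ r] exI[of _ "r + 1"]) auto
      qed
    qed
  qed
qed

context two_layer
begin

lemma canonical_pend_le:
  assumes Q: "p ` Y = {2..\<alpha> + 1} \<union> {m - \<beta>..m - 1}" and E2: "\<And>x. x \<in> E \<Longrightarrow> p x = 2"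
    and "1 \<le> i" "i < m - \<beta>"
  shows "pend_le i = min (i - 1) \<alpha> + (if 2 \<le> i then card E else 0)"
proof -
  have "{j \<in> p ` Y. j \<le> i} = {2..min i (\<alpha> + 1)}" unfolding Q using assms(3,4) by auto
  moreover have "{x \<in> E. p x \<le> i} = (if 2 \<le> i then E else {})" using E2 by auto
  ultimately show ?thesis unfolding pend_le_def card_split[of "\<lambda>j. j \<le> _"] by auto
qed

text \<open>The inequalities say that the two ends, with the surplus vertex counted on the left,
  differ in weight by at most one. Then no signed imbalance of a mirror pair is negative, and the
  middle edge has just the imbalance that parity enforces.\<close>

lemma mostar_balanced:
  assumes Q: "p ` Y = {2..\<alpha> + 1} \<union> {m - \<beta>..m - 1}" and k: "\<alpha> + \<beta> = card Y"
    and E2: "\<And>x. x \<in> E \<Longrightarrow> p x = 2" and "\<alpha> \<le> \<beta> + 1" "\<alpha> + card E \<le> \<beta> + 1" "\<beta> \<le> \<alpha> + 1"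
  shows "mostar G \<le> min_mostar m (card Y) (card E)"
proof -
  have m: "\<alpha> + \<beta> + 2 \<le> m" using card_Y_le k m2 by simp
  note le = canonical_pend_le[OF Q E2]
  have gt: "pend_gt i = min (i - 1) \<beta>" if "i \<in> {1..half}" for i
  proof -
    have i: "1 \<le> i" "2 * i < m" using half[OF that] by auto
    have "{j \<in> p ` Y. m - i < j} = {max (m - i + 1) (m - \<beta>)..m - 1}" unfolding Q using i m assms by auto
    moreover have "{x \<in> E. m - i < p x} = {}" using E2 i by force
    then have "card {x \<in> E. m - i < p x} = 0" by (simp only: card.empty)
    ultimately show ?thesis using i m unfolding pend_gt_def card_split[of "\<lambda>j. m - _ < j"] by auto
  qed
  have slack: "pair_slack i = 0" if "i \<in> {1..half}" for i
  proof -
    have i: "1 \<le> i" "2 * i < m" "i < m - \<beta>" using half[OF that] m assms by auto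
    have "2 * (i + pend_le i) \<le> m + card X" using le[of i] i assms card_X card_E by auto
    moreover have "2 * (i + pend_gt i) \<le> m + card X" using gt[OF that] i assms card_X by auto
    moreover have "min (i - 1) \<alpha> + min (i - 1) \<beta> = min (2 * i - 2) (\<alpha> + \<beta>)"
      using assms(4,6) by (auto simp: min_def)
    then have "pend_le i + pend_gt i = max_outer (card Y) (card E) i"
      using le[of i] gt[OF that] i k unfolding max_outer_def by simp
    ultimately have
      "int (2 * (i + pend_le i)) \<le> int (m + card X)" "int (2 * (i + pend_gt i)) \<le> int (m + card X)"
      and s: "int (pend_le i) + int (pend_gt i) = int (max_outer (card Y) (card E) i)"
      by (simp_all only: of_nat_le_iff flip: of_nat_add)
    then have "0 \<le> order - 2 * (int i + int (pend_le i))" "0 \<le> order - 2 * (int i + int (pend_gt i))"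
      by (simp_all add: order_def)
    then show ?thesis unfolding pair_slack_def s[symmetric] by simp
  qed
  have "mid_slack = 0"
  proof (cases "even m")
    case True
    then obtain c where c: "m = 2 * c" by blast
    \<comment> \<open>Excludes a surplus vertex when \<open>c = 1\<close>, where the case
      distinction in \<open>le\<close> would not count it.\<close>
    have "card E = 0" if "\<alpha> + \<beta> = 0" using that k finite_YE E_pos by auto
    then have "pend_le c = \<alpha> + card E" using le[of c] c m assms by (auto simp: min_def)
    moreover have o: "order = 2 * int c + int \<alpha> + int \<beta> + int (card E)"
      unfolding order_def using c card_X k by simp
    ultimately have "mid_slack = \<bar>int \<beta> - int \<alpha> - int (card E)\<bar>
        - (2 * int c + int \<alpha> + int \<beta> + int (card E)) mod 2"
      unfolding mid_slack_def o using c by simp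
    moreover have "int \<beta> - int \<alpha> - int (card E) \<in> {-1, 0, 1}" using assms by auto
    ultimately show ?thesis by (auto; presburger)
  qed (simp add: mid_slack_def)
  then show ?thesis using mostar_slack slack by simp
qed

text \<open>Both pendent vertices sit at position 2, so the left end outweighs the right one by two.
  Only edges at the middle of the spine notice: the innermost mirror pair for odd \<open>m\<close>,
  the middle edge for even \<open>m\<close>, at a cost of at most 2.\<close>

lemma mostar_unbalanced_single:
  assumes Q: "p ` Y = {2}" and E1: "card E = 1" and E2: "\<And>x. x \<in> E \<Longrightarrow> p x = 2"
  shows "mostar G \<le> min_mostar m (card Y) (card E) + 2"
proof -
  have Y1: "card Y = 1" using card_pos Q by simp
  then have m: "3 \<le> m" using card_Y_le m2 by linarith
  have order: "order = int m + 2" using card_X Y1 E1 by (simp add: order_def)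
  have Q': "p ` Y = {2..1 + 1} \<union> {m - 0..m - 1}" using Q m by auto
  have le: "pend_le i = (if 2 \<le> i then 2 else 0)" if "1 \<le> i" "i < m" for i
    using canonical_pend_le[OF Q' E2, of i] that E1 by auto
  have gt: "pend_gt i = 0" if "i \<in> {1..half}" for i
  proof -
    have "p x = 2" if "x \<in> X" for x using that X_eq Q E2 by blast
    then have "{x \<in> X. m - i < p x} = {}" using half[OF that] by force
    then show ?thesis unfolding pend_gt_def by (simp only: card.empty)
  qed
  have slack: "pair_slack i \<le> (if i = m div 2 then 2 else 0)" if "i \<in> {1..half}" for i
  proof (cases "2 \<le> i")
    case True
    then have "max_outer (card Y) (card E) i = 2" using Y1 E1 by (simp add: max_outer_def)
    then have "pair_slack i = \<bar>int m - 2 * int i - 2\<bar> + \<bar>int m + 2 - 2 * int i\<bar> - 2 * (int m - 2 * int i)"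
      using le[of i] gt[OF that] half[OF that] True by (simp add: pair_slack_def order)
    moreover have "2 * int i + 2 \<le> int m \<or> (2 * int i + 1 = int m \<and> i = m div 2)"
      using half[OF that] by linarith
    ultimately show ?thesis by auto
  next
    case False
    then have "i = 1" using that by simp
    then have "pair_slack i = 0"
      using le[of i] gt[OF that] half[OF that] by (simp add: pair_slack_def order max_outer_def)
    then show ?thesis by simp
  qed
  show ?thesis
  proof (cases "even m")
    case True
    then have "m div 2 \<notin> {1..half}" using half[of "m div 2"] by auto
    then have "pair_slack i \<le> 0" if "i \<in> {1..half}" for i using slack[OF that] that by (auto split: if_splits)
    then have "(\<Sum>i=1..half. pair_slack i) \<le> 0" by (rule sum_nonpos)
    moreover have "mid_slack \<le> 2"
    proof -
      obtain c where c: "m = 2 * c" using True by blast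
      then have "pend_le c = 2" using le[of c] m by auto
      then show ?thesis unfolding mid_slack_def order using c by simp
    qed
    ultimately show ?thesis using mostar_slack by linarith
  next
    case False
    have "(\<Sum>i=1..half. pair_slack i) \<le> (\<Sum>i=1..half. if i = m div 2 then 2 else 0)"
      by (intro sum_mono slack)
    also have "\<dots> \<le> 2" by (simp add: sum.delta)
    finally show ?thesis using mostar_slack False by (simp add: mid_slack_def)
  qed
qed

lemma tight_canonical:
  assumes "mostar G \<le> min_mostar m (card Y) (card E)"
  shows "\<exists>\<alpha> \<beta>. \<alpha> + \<beta> = card Y \<and> \<alpha> \<le> \<beta> + 1 \<and> \<beta> \<le> \<alpha> + 1 \<and> p ` Y = {2..\<alpha> + 1} \<union> {m - \<beta>..m - 1}"
proof -
  have "i \<in> {1..half}" if "1 \<le> i" "2 * i < m" for i using that by (auto simp: half_def)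
  then show ?thesis
    using balanced_positions[OF m2 pos_subset] tight_pos(1)[OF assms] card_pos by simp
qed

text \<open>The pair \<open>i = 2\<close> already requires the surplus vertex within the two
  outermost positions of one side. For \<open>m \<le> 4\<close> there are no other inner
  positions.\<close>

lemma tight_E:
  assumes "mostar G \<le> min_mostar m (card Y) (card E)" "x \<in> E"
  shows "p x = 2 \<or> p x = m - 1"
proof (cases "4 < m")
  case True
  then have two: "2 \<in> {1..half}" by (auto simp: half_def)
  have "E = {x}" using assms(2) card_E finite_YE by (metis card_le_Suc0_iff_eq One_nat_def empty_iff insertI1 subsetI subset_antisym singletonD)
  then have "card {y \<in> {x}. p y \<le> 2} + card {y \<in> {x}. m - 2 < p y} = 1"
    using tight_pos(2)[OF assms(1) two] by simp
  moreover have "{y \<in> {x}. p y \<le> 2} = {}" "{y \<in> {x}. m - 2 < p y} = {}"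
    if "\<not> (p x \<le> 2 \<or> m - 2 < p x)" using that by auto
  ultimately have "p x \<le> 2 \<or> m - 2 < p x" by (metis card.empty add_0 zero_neq_one)
  then show ?thesis using p_inner[of x] assms(2) X_eq by auto
next
  case False
  then show ?thesis using p_inner[of x] assms(2) X_eq by auto
qed

text \<open>The surplus vertex on the heavier side gives a difference of two. If there is a gap
  between the blocks, the middle edge (even \<open>m\<close>) or the innermost pair (odd
  \<open>m\<close>) has positive slack. Without a gap the border between the blocks is only a matter
  of notation.\<close>

lemma tight_sides:
  assumes opt: "mostar G \<le> min_mostar m (card Y) (card E)"
    and Q: "p ` Y = {2..\<alpha> + 1} \<union> {m - \<beta>..m - 1}" and k: "\<alpha> + \<beta> = card Y" and \<alpha>: "\<alpha> = \<beta> + 1"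
    and E1: "card E = 1" and E2: "\<And>x. x \<in> E \<Longrightarrow> p x = 2"
  shows "\<alpha> + \<beta> + 2 = m"
proof (rule ccontr)
  assume "\<alpha> + \<beta> + 2 \<noteq> m"
  then have m: "2 * \<beta> + 4 \<le> m" using card_Y_le k \<alpha> m2 by linarith
  show False
  proof (cases "even m")
    case True
    then obtain c where c: "m = 2 * c" by blast
    have "pend_le c = \<alpha> + 1" using canonical_pend_le[OF Q E2, of c] c m \<alpha> E1 by auto
    moreover have cX: "int (card X) = 2 * (int \<beta> + 1)" using k \<alpha> E1 card_X by simp
    ultimately have "mid_slack = 2" unfolding mid_slack_def order_def cX using c \<alpha> by simp
    then show False using mid_slack_le opt by simp
  next
    case False
    then obtain c where c: "m = Suc (2 * c)" by (auto elim: oddE)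
    have "pend_le c = \<alpha> + 1" using canonical_pend_le[OF Q E2, of c] c m \<alpha> E1 by auto
    moreover have "c \<in> {1..half}" unfolding half_def using c m by auto
    then have "2 * (c + pend_le c) \<le> m + card X" by (rule tight(2)[OF assms(1)])
    ultimately show False using c k \<alpha> E1 card_X by simp
  qed
qed

text \<open>If the common position is further inside, the pair \<open>i = 2\<close> misses both
  pendent vertices and has slack 4, more than the tolerance of 2.\<close>

lemma single_position:
  assumes "card Y = 1" "card E = 1" "mostar G \<le> min_mostar m (card Y) (card E) + 2" "x \<in> X"
  shows "p x = 2 \<or> p x = m - 1"
proof (rule ccontr)
  assume no: "\<not> ?thesis"
  obtain y where Y: "Y = {y}" using assms(1) by (auto simp: card_1_singleton_iff)
  have eq: "p z = p x" if "z \<in> X" for z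
  proof -
    have "p z = p y" if "z \<in> X" for z using that X_eq E_pos Y by blast
    then show ?thesis using that assms(4) by metis
  qed
  have px: "3 \<le> p x" "p x \<le> m - 2" using p_inner[OF assms(4)] no by auto
  then have two: "2 \<in> {1..half}" by (auto simp: half_def)
  have "{z \<in> X. p z \<le> 2} = {}" "{z \<in> X. m - 2 < p z} = {}" using eq px by fastforce+
  then have "pend_le 2 = 0" "pend_gt 2 = 0" unfolding pend_le_def pend_gt_def by (simp_all only: card.empty)
  moreover have "max_outer (card Y) (card E) 2 = 2" using assms by (simp add: max_outer_def)
  moreover have "order \<ge> 4" using px by (simp add: order_def)
  ultimately have "pair_slack 2 = 4" by (simp add: pair_slack_def)
  then show False using pair_slack_le[OF two] assms(3) by simp
qed

end

lemma two_layer_isomorphic: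
  assumes "two_layer G m v X p Y E" "two_layer H m v' X' p' Y' E'"
    and "p ` Y = p' ` Y'" "card E = card E'" "\<And>x. x \<in> E \<Longrightarrow> p x = 2" "\<And>x. x \<in> E' \<Longrightarrow> p' x = 2"
  shows "isomorphic G H"
proof -
  interpret G: two_layer G m v X p Y E by fact
  interpret H: two_layer H m v' X' p' Y' E' by fact
  have "card {x \<in> X. p x = i} = card {x \<in> X'. p' x = i}" for i
  proof -
    have "{x \<in> E. p x = i} = (if i = 2 then E else {})" "{x \<in> E'. p' x = i} = (if i = 2 then E' else {})"
      using assms(5,6) by auto
    then show ?thesis
      unfolding G.card_split[of "\<lambda>j. j = i"] H.card_split[of "\<lambda>j. j = i"] assms(3)
      using assms(4) by (simp split: if_splits)
  qed
  then show ?thesis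
    using caterpillar_isomorphic[OF G.caterpillar_axioms H.caterpillar_axioms] by blast
qed

section \<open>The extremal trees\<close>

text \<open>\<open>U 1\<close> occurs only in \<open>F_graph\<close>, as the second pendent vertex
  at \<open>V 2\<close>; this is the reason for \<open>max 2 i\<close>.\<close>

fun label_pos :: "label \<Rightarrow> nat" where
  "label_pos (V i) = i"
| "label_pos (U i) = max 2 i"

lemma path_edges_eq: "path_edges m = (\<lambda>i. {V i, V (Suc i)}) ` {1..<m}"
  by (auto simp: path_edges_def)

lemma two_layer_C_graph:
  assumes "a + b + 2 \<le> m" "n = m + a + b"
  defines "I \<equiv> {2..a + 1} \<union> {m - b..m - 1}"
  shows "two_layer (C_graph n a b) m V (U ` I) label_pos (U ` I) {}"
    and "label_pos ` U ` I = I" and "card (U ` I) = a + b"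
proof -
  have I: "I \<subseteq> {2..m - 1}" using assms(1) by (auto simp: I_def)
  have pos: "label_pos (U i) = i" if "i \<in> I" for i using I that by auto
  have C: "C_graph n a b = \<lparr>verts = V ` {1..m} \<union> U ` I, edges = path_edges m \<union> {{V i, U i} | i. i \<in> I}\<rparr>"
  proof -
    have "n - a - b = m" "n - a - 2 * b = m - b" "n - a - b - 1 = m - 1" using assms(2) by simp_all
    then show ?thesis by (simp add: C_graph_def I_def Let_def)
  qed
  have "(\<lambda>x. {V (label_pos x), x}) ` U ` I = {{V i, U i} | i. i \<in> I}"
    unfolding image_image using pos by (auto simp: image_iff)
  then have edges: "edges (C_graph n a b) =
      (\<lambda>i. {V i, V (Suc i)}) ` {1..<m} \<union> (\<lambda>x. {V (label_pos x), x}) ` U ` I"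
    by (simp only: C path_edges_eq ugraph.simps)
  show "two_layer (C_graph n a b) m V (U ` I) label_pos (U ` I) {}"
  proof
    show "inj_on V {1..m}" "V ` {1..m} \<inter> U ` I = {}" by (auto simp: inj_on_def)
    show "label_pos x \<in> {2..m - 1}" if x: "x \<in> U ` I" for x
    proof -
      from x obtain i where "i \<in> I" "x = U i" by (elim imageE)
      then show ?thesis using pos[of i] I by auto
    qed
    show "verts (C_graph n a b) = V ` {1..m} \<union> U ` I" by (simp only: C ugraph.simps)
    show "inj_on label_pos (U ` I)" using pos by (auto simp: inj_on_def)
  qed (use assms(1) edges in \<open>auto simp: I_def\<close>)
  show "label_pos ` U ` I = I" using pos by (simp add: image_image)
  have "card (U ` I) = card I" by (rule card_image) (simp add: inj_on_def)
  also have "\<dots> = a + b" unfolding I_def using assms(1) by (subst card_Un_disjoint) auto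
  finally show "card (U ` I) = a + b" .
qed

text \<open>The left block has \<open>a + 1\<close> positions, as the pendent vertices of the first
  layer there are \<open>U 2\<close> up to \<open>U (a + 2)\<close>; \<open>U 1\<close> forms the
  second layer.\<close>

lemma two_layer_F_graph:
  assumes "a + b + 3 \<le> m" "n = m + a + b + 2"
  defines "I \<equiv> {2..(a + 1) + 1} \<union> {m - b..m - 1}"
  shows "two_layer (F_graph n a b) m V (insert (U 1) (U ` I)) label_pos (U ` I) {U 1}"
    and "label_pos ` U ` I = I" and "card (U ` I) = a + b + 1"
proof -
  have I: "I \<subseteq> {2..m - 1}" using assms(1) by (auto simp: I_def)
  have pos: "label_pos (U i) = i" if "i \<in> I" for i using I that by auto
  have F: "F_graph n a b = \<lparr>verts = V ` {1..m} \<union> {U 1} \<union> U ` I,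
      edges = path_edges m \<union> {{V 2, U 1}} \<union> {{V i, U i} | i. i \<in> I}\<rparr>"
  proof -
    have "n - a - b - 2 = m" "n - a - 2 * b - 2 = m - b" "n - a - b - 3 = m - 1" using assms(2) by simp_all
    then show ?thesis by (simp add: F_graph_def I_def Let_def)
  qed
  have "(\<lambda>x. {V (label_pos x), x}) ` U ` I = {{V i, U i} | i. i \<in> I}"
    unfolding image_image using pos by (auto simp: image_iff)
  moreover have "label_pos (U 1) = 2" by simp
  ultimately have edges: "edges (F_graph n a b) =
      (\<lambda>i. {V i, V (Suc i)}) ` {1..<m} \<union> (\<lambda>x. {V (label_pos x), x}) ` insert (U 1) (U ` I)"
    unfolding image_insert by (simp only: F path_edges_eq ugraph.simps) blast
  have "2 \<in> I" by (simp add: I_def)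
  show "two_layer (F_graph n a b) m V (insert (U 1) (U ` I)) label_pos (U ` I) {U 1}"
  proof
    show "inj_on V {1..m}" "V ` {1..m} \<inter> insert (U 1) (U ` I) = {}" by (auto simp: inj_on_def)
    show "label_pos x \<in> {2..m - 1}" if x: "x \<in> insert (U 1) (U ` I)" for x
    proof (cases "x = U 1")
      case False
      with x obtain i where "i \<in> I" "x = U i" by auto
      then show ?thesis using pos[of i] I by auto
    qed (use assms(1) in simp)
    show "verts (F_graph n a b) = V ` {1..m} \<union> insert (U 1) (U ` I)" by (auto simp: F)
    show "inj_on label_pos (U ` I)" using pos by (auto simp: inj_on_def)
    have "label_pos (U 1) = label_pos (U 2)" by simp
    then show "label_pos ` {U 1} \<subseteq> label_pos ` U ` I" using \<open>2 \<in> I\<close> by blast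
    show "U ` I \<inter> {U 1} = {}" using I by auto
  qed (use assms(1) edges in \<open>auto simp: I_def\<close>)
  show "label_pos ` U ` I = I" using pos by (simp add: image_image)
  have "card (U ` I) = card I" by (rule card_image) (simp add: inj_on_def)
  also have "\<dots> = a + b + 1" unfolding I_def using assms(1) by (subst card_Un_disjoint) auto
  finally show "card (U ` I) = a + b + 1" .
qed

text \<open>The competitor \<open>H\<close> may live on another type; it is copied onto the vertices of \<open>T\<close>.\<close>

lemma minimal_le_caterpillar:
  fixes T :: "'a ugraph" and H :: "'b ugraph"
  assumes T: "T \<in> trees_deg2 n t" and min: "\<forall>T' \<in> (trees_deg2 n t :: 'a ugraph set). mostar T \<le> mostar T'"
    and H: "caterpillar H m v X p" and n: "m + card X = n" and t: "m - 2 - card (p ` X) = t"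
  shows "mostar T \<le> mostar H"
proof -
  interpret H: caterpillar H m v X p by fact
  have "finite (verts T)" "card (verts T) = n" using T by (auto simp: trees_deg2_def treeD)
  then obtain h where "bij_betw h (verts H) (verts T)"
    using finite_same_card_bij[OF H.finite_verts, of "verts T"] H.card_verts n by auto
  then have h: "inj_on h (verts H)" by (rule bij_betw_imp_inj_on)
  have hX: "inj_on h X" by (rule inj_on_subset[OF h]) (simp add: H.verts_eq)
  let ?H = "\<lparr>verts = h ` verts H, edges = (`) h ` edges H\<rparr>"
  let ?p = "p \<circ> inv_into X h"
  interpret I: caterpillar ?H m "h \<circ> v" "h ` X" ?p by (rule H.image_caterpillar[OF h])
  have cX: "card (h ` X) = card X" by (rule card_image[OF hX])
  have "?p ` (h ` X) = p ` X" unfolding image_image by (rule image_cong[OF refl]) (simp add: inv_into_f_f[OF hX])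
  then have "?H \<in> trees_deg2 n t"
    using I.tree I.card_verts I.card_degree_two cX n t by (simp add: trees_deg2_def)
  moreover have "I.pend_le i = H.pend_le i" for i
  proof -
    have "{x \<in> h ` X. ?p x \<le> i} = h ` {x \<in> X. p x \<le> i}" using inv_into_f_f[OF hX] by auto
    moreover have "inj_on h {x \<in> X. p x \<le> i}" by (rule inj_on_subset[OF hX]) auto
    ultimately show ?thesis unfolding I.pend_le_def H.pend_le_def by (simp only: card_image)
  qed
  then have "mostar ?H = mostar H"
    using I.mostar_eq H.mostar_eq I.card_verts H.card_verts cX by simp
  ultimately show ?thesis using min by fastforce
qed

section \<open>Structure of the trees that reach the bound\<close>

context longest_path
begin

lemma card_pos_eq:
  assumes "caterpillar G m v off p" "m - 2 = t + k" "card {x \<in> verts G. degree G x = 2} = t"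
    "k \<le> card (p ` off)"
  shows "card (p ` off) = k"
proof -
  interpret C: caterpillar G m v off p by fact
  have "p ` off \<subseteq> {2..m - 1}" using C.p_inner by blast
  from card_mono[OF _ this] have "card (p ` off) \<le> m - 2" by simp
  then show ?thesis using C.card_degree_two assms(2-4) by linarith
qed

text \<open>At most one vertex \<open>y\<close> off the path is no representative. If
  \<open>y\<close> were not attached to the path, its neighbour would be a representative
  \<open>w\<close>, adjacent to both \<open>y\<close> and the path, of degree other than two; a
  third neighbour of \<open>w\<close> would close a cycle.\<close>

lemma longest_two_layer:
  assumes "m = t + k + 2" and t: "card {x \<in> verts G. degree G x = 2} = t"
    and "card off = k + \<epsilon>" "\<epsilon> \<le> 1"
  shows "\<exists>p Y E. two_layer G m v off p Y E \<and> card Y = k \<and> card E = \<epsilon>"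
proof -
  let ?Y = "attached ` branching"
  have Y: "?Y \<subseteq> off" "card ?Y = card branching"
    using attached card_image[OF inj_attached] by blast+
  have q: "k \<le> card branching" using card_branching_ge assms(1) t by linarith
  have ex: "\<exists>i\<in>{1..m}. adj G (v i) y" if y: "y \<in> off" for y
  proof (rule ccontr)
    assume no: "\<not> ?thesis"
    then have "y \<notin> ?Y" using attached branching_subset by blast
    then have "insert y ?Y \<subseteq> off" "card (insert y ?Y) = Suc (card branching)"
      using y Y finite_subset[OF Y(1)] by simp_all
    then have "Suc (card branching) \<le> card off" using card_mono[OF finite_off] by metis
    then have cb: "card branching = k" and "card (insert y ?Y) = card off"
      using assms(3,4) q \<open>card (insert y ?Y) = _\<close> by linarith+
    then have off: "insert y ?Y = off" by (intro card_subset_eq[OF finite_off \<open>insert y ?Y \<subseteq> off\<close>])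
    \<comment> \<open>The inner path positions that are not branching already account for all
      \<open>t\<close> vertices of degree two.\<close>
    have deg: "degree G w \<noteq> 2" if "w \<in> off" for w
    proof -
      let ?D = "v ` ({2..m - 1} - branching)"
      have "branching \<subseteq> {2..m - 1}" by (auto simp: branching_def)
      then have "card ({2..m - 1} - branching) = t"
        unfolding card_Diff_subset[OF finite_branching \<open>branching \<subseteq> {2..m - 1}\<close>] cb using assms(1) by simp
      moreover have "inj_on v ({2..m - 1} - branching)" by (rule inj_on_subset[OF inj]) auto
      ultimately have "card ?D = card {x \<in> verts G. degree G x = 2}" using t by (simp add: card_image)
      moreover have "?D \<subseteq> {x \<in> verts G. degree G x = 2}"
        by (auto simp: branching_def intro!: v_in_verts)
      ultimately have "?D = {x \<in> verts G. degree G x = 2}"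
        using card_subset_eq[of "{x \<in> verts G. degree G x = 2}" ?D] G(3) by simp
      moreover have "w \<notin> ?D" by (rule off_notin[OF that]) auto
      moreover have "w \<in> verts G" using that by (simp add: off_def)
      ultimately show ?thesis by blast
    qed
    have "v 1 \<in> verts G" "y \<in> verts G" "y \<noteq> v 1"
      using y v_in_verts[of 1] off_notin[OF y, of "{1}"] m_pos by (auto simp: off_def)
    then obtain r where r: "walk_between G y r (v 1)" using G(2) by (auto simp: connected_graph_def)
    obtain w where w: "adj G y w"
    proof (cases r)
      case (Cons a r')
      then have "a = y" "r' \<noteq> []" using r \<open>y \<noteq> v 1\<close> by (auto simp: walk_between_def)
      then have "adj G y (hd r')" using r Cons by (auto simp: walk_between_def walk_def successively_Cons)
      then show ?thesis by (rule that)
    qed (use r in \<open>simp add: walk_between_def walk_def\<close>)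
    have wy: "adj G w y" using w by (simp only: adj_commute)
    have off_cases: "z \<in> ?Y \<or> z = y \<or> (\<exists>j\<in>{1..m}. z = v j)" if "adj G w z \<or> adj G y z" for z
      using that adj_simpleD[OF G(1)] off by (fastforce simp: off_def)
    have "\<not> (\<exists>j\<in>{1..m}. w = v j)" using no wy by blast
    moreover have "w \<noteq> y" using adj_simpleD(3)[OF G(1) w] by simp
    ultimately have "w \<in> ?Y" using off_cases[of w] w by blast
    then obtain i where i: "i \<in> branching" "w = attached i" by blast
    have woff: "w \<in> off" using \<open>w \<in> ?Y\<close> Y by blast
    have wi: "adj G w (v i)" "i \<in> {1..m}" using attached[OF i(1)] i branching_subset by auto
    have "v i \<noteq> y" using off_notin[OF y, of "{1..m}"] wi(2) by blast
    then obtain z where z: "adj G w z" "z \<noteq> v i" "z \<noteq> y"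
      using third_neighbour[OF G(1) wi(1) wy _ deg[OF woff]] by blast
    from off_cases[of z] z(1,3) consider j where "j \<in> {1..m}" "z = v j" | j where "j \<in> branching" "z = attached j"
      by blast
    then show False
    proof cases
      case 1
      then show ?thesis using attach_unique[OF woff wi(2) 1(1) wi(1)] z by simp
    next
      case 2
      then show ?thesis
        using attach_not_adj[OF woff, of z i j] attached[OF 2(1)] branching_subset wi z(1) by auto
    qed
  qed
  define p where "p y = (SOME i. i \<in> {1..m} \<and> adj G (v i) y)" for y
  have p: "p y \<in> {1..m} \<and> adj G (v (p y)) y" if "y \<in> off" for y
    unfolding p_def by (rule someI_ex) (use ex[OF that] in blast)
  have pa: "p (attached i) = i" if "i \<in> branching" for i
  proof (rule attach_unique)
    show "attached i \<in> off" "i \<in> {1..m}" "adj G (attached i) (v i)"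
      using attached[OF that] branching_subset that by auto
    show "p (attached i) \<in> {1..m}" "adj G (attached i) (v (p (attached i)))"
      using p[OF attached(1)[OF that]] by (simp_all only: adj_commute)
  qed
  have pY: "p ` ?Y = branching" using pa by force
  have "2 \<le> m" using assms(1) by simp
  then interpret C: caterpillar G m v off p by (rule caterpillar) (rule p)
  have "p ` ?Y \<subseteq> p ` off" using Y(1) by blast
  then have le: "card branching \<le> card (p ` off)" unfolding pY by (rule card_mono[rotated]) simp
  have c: "card (p ` off) = k"
    by (rule card_pos_eq[OF C.caterpillar_axioms _ t]) (use assms(1) le q in simp_all)
  then have cb: "card branching = k" using le q by simp
  \<comment> \<open>The representatives already occupy every position, so a remaining vertex doubles
    one of them and can form the second layer.\<close>
  have "p ` ?Y = p ` off"
    by (rule card_subset_eq) (use \<open>p ` ?Y \<subseteq> p ` off\<close> c cb pY in auto)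
  moreover have "inj_on p ?Y" using pa by (auto simp: inj_on_def)
  moreover have "card (off - ?Y) = \<epsilon>"
    using Y cb assms(3) card_Diff_subset[OF finite_subset[OF Y(1) finite_off] Y(1)] by simp
  ultimately have "two_layer G m v off p ?Y (off - ?Y)"
    using Y(1) assms(4) by unfold_locales auto
  then show ?thesis using \<open>card (off - ?Y) = \<epsilon>\<close> Y(2) cb by blast
qed

text \<open>Compared with the general charge \<open>m - 1\<close>, the representative at position
  \<open>i\<close> saves twice the distance of \<open>i\<close> to the nearer end of
  \<open>{2..m - 1}\<close>. By \<open>sum_min_ends\<close> the total saving is least when the
  branching positions crowd at both ends.\<close>

lemma mostar_ge: "mostar G \<ge> int (card (verts G)) * (int (card (verts G)) - 1)
    - twice_sides_bound (card (verts G)) m (card branching)"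
proof -
  have pos: "\<bar>2 * int i - int m - 1\<bar> + 2 = (int m - 1) - 2 * min (int i - 2) (int m - 1 - int i)"
    if "i \<in> branching" for i
  proof -
    have "2 \<le> int i" "int i \<le> int m - 1" using that by (auto simp: branching_def)
    then show ?thesis by (simp add: abs_if min_def)
  qed
  have "int ` branching \<subseteq> {2..int m - 1}" by (auto simp: branching_def)
  define S where "S = (\<Sum>i\<in>branching. min (int i - 2) (int m - 1 - int i))"
  from sum_min_ends[OF \<open>int ` branching \<subseteq> _\<close>] have S: "int (quarter_sq (card branching - 1)) \<le> S"
    by (simp add: S_def sum.reindex card_image)
  have "(\<Sum>i\<in>branching. \<bar>2 * int i - int m - 1\<bar> + 2) = int (card branching) * (int m - 1) - 2 * S"
    unfolding S_def using sum.cong[OF refl pos] by (simp add: sum_subtractf sum_distrib_left)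
  with sum_centre_dist have "(\<Sum>y\<in>verts G. centre_dist y) \<le> 2 * int (quarter_sq m)
      + (int (card branching) * (int m - 1) - 2 * S)
      + (int (card off) - int (card branching)) * (int m - 1)"
    unfolding sum_abs_centred by simp
  also have "\<dots> = 2 * int (quarter_sq m) + int (card off) * (int m - 1) - 2 * S"
    by (simp add: algebra_simps)
  also have "int (card off) = int (card (verts G)) - int m" using card_off by linarith
  finally have "(\<Sum>y\<in>verts G. centre_dist y) \<le> twice_sides_bound (card (verts G)) m (card branching)"
    using S unfolding twice_sides_bound_def by linarith
  then show ?thesis using mostar_ge_centre_dist by linarith
qed

end

lemma minimal_two_layer:
  assumes T: "T \<in> trees_deg2 n t" and n: "n = t + 2 * k + 2 + \<epsilon>" and "1 \<le> k" "\<epsilon> \<le> 1"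
    and le: "mostar T \<le> min_mostar (t + k + 2) k \<epsilon> + (if k = 1 \<and> \<epsilon> = 1 then 2 else 0)"
  shows "\<exists>v X p Y E. two_layer T (t + k + 2) v X p Y E \<and> card Y = k \<and> card E = \<epsilon>"
proof -
  have T': "tree T" "card (verts T) = n" "card {w \<in> verts T. degree T w = 2} = t"
    using T by (auto simp: trees_deg2_def)
  obtain m v where "longest_path T m v" using ex_longest_path[OF T'(1)] by blast
  then interpret longest_path T m v .
  define M where "M = t + k + 2"
  have nM: "n = M + k + \<epsilon>" using n by (simp add: M_def)
  have q: "m \<le> card branching + t + 2" using card_branching_ge T'(3) by simp
  have "m + card branching \<le> n" using card_branching_le card_off T'(2) by linarith
  then have "m \<le> M" using q n assms(4) unfolding M_def by linarith
  moreover have "\<not> m < M"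
  proof
    assume "m < M"
    from twice_sides_bound_less[OF this M_def nM assms(3) q assms(4)]
    have "mostar T \<ge> int n * (int n - 1) - twice_sides_bound n M k + 2 + int \<epsilon>"
      using mostar_ge T'(2) by simp
    moreover have "min_mostar M k \<epsilon> = int n * (int n - 1) - twice_sides_bound n M k
        + (if even M then int n mod 2 else 0)"
      by (rule min_mostar_eq) (use nM assms(3) in \<open>auto simp: M_def\<close>)
    \<comment> \<open>Parity and tolerance together stay below the margin. In the exceptional case
      \<open>n = M + 2\<close>, so for even \<open>M\<close> the parity term vanishes and only the
      tolerance 2 is left against a margin of 3.\<close>
    moreover have "(if even M then int n mod 2 else 0) + (if k = 1 \<and> \<epsilon> = 1 then 2 else 0) < 2 + int \<epsilon>"
    proof (cases "k = 1 \<and> \<epsilon> = 1 \<and> even M")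
      case True
      then have "even n" using nM by simp
      then have "int n mod 2 = 0" by presburger
      then show ?thesis using True by simp
    next
      case False
      have "int n mod 2 < 2" "0 \<le> int n mod 2" by simp_all
      then show ?thesis using False by auto
    qed
    ultimately show False using le unfolding M_def[symmetric] by linarith
  qed
  ultimately have m: "m = M" by simp
  have "card off = k + \<epsilon>" using card_off T'(2) m nM by linarith
  from longest_two_layer[OF _ T'(3) this assms(4)] show ?thesis using m unfolding M_def by blast
qed

lemma ceiling_half: "nat \<lceil>real k / 2\<rceil> = (k + 1) div 2"
proof -
  have "\<lceil>real k / 2\<rceil> = int ((k + 1) div 2)"
    by (cases "even k") (auto elim!: evenE oddE simp: ceiling_unique add_divide_distrib intro!: ceiling_unique)
  then show ?thesis by simp
qed

lemma floor_half: "nat \<lfloor>real k / 2\<rfloor> = k div 2"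
  using floor_divide_of_nat_eq[of k 2, where ?'a = real] by simp

section \<open>Identification of the minimal tree\<close>

context
  fixes n t :: nat and T :: "'a ugraph"
  assumes T: "T \<in> trees_deg2 n t"
    and min: "\<forall>T' \<in> (trees_deg2 n t :: 'a ugraph set). mostar T \<le> mostar T'"
begin

lemma minimal_le_two_layer:
  assumes "two_layer H m v X p Y E" "m + card Y + card E = n" "m = t + card Y + 2"
  shows "mostar T \<le> mostar H"
proof -
  interpret two_layer H m v X p Y E by fact
  have "p ` X = p ` Y" using X_eq E_pos by blast
  then show ?thesis
    using minimal_le_caterpillar[OF T min caterpillar_axioms] card_X card_pos assms(2,3) by simp
qed

lemma minimal_isomorphic_C:
  assumes n: "n = t + 2 * k + 2" and k: "1 \<le> k"
  shows "isomorphic T (C_graph n ((k + 1) div 2) (k div 2))"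
proof -
  define a b m where "a = (k + 1) div 2" and "b = k div 2" and "m = t + k + 2"
  have ab: "a + b = k" "a \<le> b + 1" "b \<le> a" unfolding a_def b_def by linarith+
  have m: "a + b + 2 \<le> m" "n = m + a + b" using ab n by (simp_all add: m_def)
  let ?Y = "U ` ({2..a + 1} \<union> {m - b..m - 1})"
  note C = two_layer_C_graph[OF m]
  interpret C: two_layer "C_graph n a b" m V ?Y label_pos ?Y "{}" by (rule C(1))
  have "mostar T \<le> mostar (C_graph n a b)"
    by (rule minimal_le_two_layer[OF C(1)]) (use C(3) m ab in \<open>simp_all add: m_def\<close>)
  also have "\<dots> \<le> min_mostar m k 0"
    using C.mostar_balanced[OF C(2)] C(3) ab by simp
  finally have le: "mostar T \<le> min_mostar m k 0" .
  then obtain v X p Y E where T2: "two_layer T m v X p Y E" and Y: "card Y = k" and E: "card E = 0"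
    using minimal_two_layer[OF T, of k 0] n k by (auto simp: m_def)
  interpret T2: two_layer T m v X p Y E by fact
  have [simp]: "E = {}" using E T2.finite_YE by simp
  have le: "mostar T \<le> min_mostar m (card Y) (card E)" using le Y E by simp
  from T2.tight_canonical[OF this] obtain \<alpha> \<beta> where
    \<alpha>\<beta>: "\<alpha> + \<beta> = card Y" "\<alpha> \<le> \<beta> + 1" "\<beta> \<le> \<alpha> + 1" "p ` Y = {2..\<alpha> + 1} \<union> {m - \<beta>..m - 1}" by blast
  \<comment> \<open>The blocks differ in size by at most one, so the tree is packed like
    \<open>C_graph\<close> or like its mirror image.\<close>
  then consider "\<alpha> = a" "\<beta> = b" | "\<alpha> = b" "\<beta> = a" using Y ab by linarith
  then have "isomorphic T (C_graph n a b)"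
  proof cases
    case 1
    then show ?thesis
      using two_layer_isomorphic[OF T2 C(1)] \<alpha>\<beta>(4) C(2) by simp
  next
    case 2
    have "(\<lambda>x. Suc m - p x) ` Y = {2..a + 1} \<union> {m - b..m - 1}"
      by (rule T2.reflect_pos) (use 2 \<alpha>\<beta>(4) m in simp_all)
    then show ?thesis
      using two_layer_isomorphic[OF T2.reflect_two_layer C(1)] C(2) by simp
  qed
  then show ?thesis by (simp only: a_def b_def)
qed

lemma minimal_isomorphic_F_single:
  assumes n: "n = t + 5"
  shows "isomorphic T (F_graph n 0 0)"
proof -
  define m where "m = t + 3"
  have m: "0 + 0 + 3 \<le> m" "n = m + 0 + 0 + 2" using n by (simp_all add: m_def)
  note F = two_layer_F_graph[OF m]
  have Q: "{2..(0 + 1) + 1} \<union> {m - 0..m - 1} = {2::nat}" using m by auto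
  interpret F: two_layer "F_graph n 0 0" m V "insert (U 1) (U ` {2})" label_pos "U ` {2}" "{U 1}"
    using F(1) unfolding Q .
  have "mostar T \<le> mostar (F_graph n 0 0)"
    by (rule minimal_le_two_layer[OF F.two_layer_axioms]) (use n in \<open>simp_all add: m_def\<close>)
  also have "\<dots> \<le> min_mostar m 1 1 + 2"
    using F.mostar_unbalanced_single by simp
  finally have le: "mostar T \<le> min_mostar m 1 1 + 2" .
  then obtain v X p Y E where T2: "two_layer T m v X p Y E" and Y: "card Y = 1" and E: "card E = 1"
    using minimal_two_layer[OF T, of 1 1] n m_def by (auto simp: numeral_3_eq_3)
  interpret T2: two_layer T m v X p Y E by fact
  obtain y where y: "Y = {y}" using Y by (auto simp: card_1_singleton_iff)
  have pE: "p x = p y" if "x \<in> E" for x using that T2.E_pos y by blast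
  have "mostar T \<le> min_mostar m (card Y) (card E) + 2" using le Y E by simp
  then have "p y = 2 \<or> p y = m - 1" using T2.single_position[OF Y E] y T2.X_eq by simp
  then show ?thesis
  proof
    assume "p y = 2"
    then show ?thesis
      using two_layer_isomorphic[OF T2 F.two_layer_axioms] y pE E by simp
  next
    assume "p y = m - 1"
    then have "Suc m - p y = 2" using m by simp
    then show ?thesis
      using two_layer_isomorphic[OF T2.reflect_two_layer F.two_layer_axioms] y pE E by simp
  qed
qed

lemma minimal_isomorphic_F:
  assumes n: "n = t + 2 * k + 3" and k: "2 \<le> k"
  shows "isomorphic T (F_graph n (k div 2 - 1) ((k + 1) div 2))"
proof -
  define a b m where "a = k div 2 - 1" and "b = (k + 1) div 2" and "m = t + k + 2"
  \<comment> \<open>The left block, which receives the surplus vertex, is not the larger one; this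
    is the balance condition of \<open>mostar_balanced\<close>.\<close>
  have ab: "a + 1 + b = k" "a + 1 \<le> b" "b \<le> a + 2" unfolding a_def b_def using k by linarith+
  have m: "a + b + 3 \<le> m" "n = m + a + b + 2" using ab n by (simp_all add: m_def)
  let ?Y = "U ` ({2..(a + 1) + 1} \<union> {m - b..m - 1})"
  note F = two_layer_F_graph[OF m]
  interpret F: two_layer "F_graph n a b" m V "insert (U 1) ?Y" label_pos ?Y "{U 1}" by (rule F(1))
  have cY: "card ?Y = k" using F(3) ab by simp
  have "mostar T \<le> mostar (F_graph n a b)"
    by (rule minimal_le_two_layer[OF F(1)]) (use cY m ab in \<open>simp_all add: m_def\<close>)
  also have "\<dots> \<le> min_mostar m k 1"
    using F.mostar_balanced[OF F(2)] cY ab by simp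
  finally have le: "mostar T \<le> min_mostar m k 1" .
  then obtain v X p Y E where T2: "two_layer T m v X p Y E" and Y: "card Y = k" and E: "card E = 1"
    using minimal_two_layer[OF T, of k 1] n k by (auto simp: m_def)
  have le': "mostar T \<le> min_mostar m (card Y) (card E)" using le Y E by simp
  \<comment> \<open>The orientation is spent on bringing the surplus vertex to position 2, so the
    blocks can no longer be swapped by reflection.\<close>
  obtain v p where T2: "two_layer T m v X p Y E" and E2: "\<And>x. x \<in> E \<Longrightarrow> p x = 2"
  proof -
    interpret T2: two_layer T m v X p Y E by fact
    obtain x where x: "E = {x}" using E by (auto simp: card_1_singleton_iff)
    then have "p x = 2 \<or> p x = m - 1" using T2.tight_E[OF le'] by simp
    then show ?thesis
    proof
      assume "p x = 2"
      then show ?thesis using that[OF T2] x by simp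
    next
      assume "p x = m - 1"
      then have "Suc m - p x = 2" using m by simp
      then show ?thesis using that[OF T2.reflect_two_layer] x by simp
    qed
  qed
  interpret T2: two_layer T m v X p Y E by fact
  from T2.tight_canonical[OF le'] obtain \<alpha> \<beta> where
    \<alpha>\<beta>: "\<alpha> + \<beta> = card Y" "\<alpha> \<le> \<beta> + 1" "\<beta> \<le> \<alpha> + 1" "p ` Y = {2..\<alpha> + 1} \<union> {m - \<beta>..m - 1}" by blast
  then consider "\<alpha> = a + 1" "\<beta> = b" | "\<alpha> = \<beta> + 1" "\<beta> = a + 1" "b = a + 2" using Y ab by linarith
  then have "p ` Y = {2..(a + 1) + 1} \<union> {m - b..m - 1}"
  proof cases
    case 1
    then show ?thesis using \<alpha>\<beta>(4) by simp
  next
    case 2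
    \<comment> \<open>The left block is the larger one, which is possible only on a fully occupied
      spine; there it gives the same set of positions.\<close>
    have "\<alpha> + \<beta> + 2 = m" by (rule T2.tight_sides[OF le' \<alpha>\<beta>(4,1) 2(1) E E2])
    then show ?thesis using \<alpha>\<beta>(4) 2 by auto
  qed
  then have "isomorphic T (F_graph n a b)"
    using two_layer_isomorphic[OF T2 F(1)] F(2) E E2 by simp
  then show ?thesis by (simp only: a_def b_def)
qed

end

theorem theorem4p2:
  fixes n t :: nat and T :: "'a ugraph"
  assumes "t + 4 \<le> n"
    and "T \<in> trees_deg2 n t"
    and "\<forall>T' \<in> (trees_deg2 n t :: 'a ugraph set). mostar T \<le> mostar T'"
  shows "(n - t = 5 \<longrightarrow> isomorphic T (F_graph n 0 0)) \<and>
    (odd (n - t) \<and> n - t \<ge> 7 \<longrightarrow>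
      isomorphic T (F_graph n (nat (\<lceil>(real n - real t - 5) / 4\<rceil> - 1))
                              (nat (\<lfloor>(real n - real t - 5) / 4\<rfloor> + 1)))) \<and>
    (even (n - t) \<longrightarrow>
      isomorphic T (C_graph n (nat \<lceil>(real n - real t) / 4 - 1 / 2\<rceil>)
                              (nat \<lfloor>(real n - real t) / 4 - 1 / 2\<rfloor>)))"
proof (intro conjI impI)
  assume "n - t = 5"
  then have "n = t + 5" by simp
  then show "isomorphic T (F_graph n 0 0)" by (rule minimal_isomorphic_F_single[OF assms(2,3)])
next
  assume odd: "odd (n - t) \<and> n - t \<ge> 7"
  then have "odd (n - t)" by simp
  then obtain j where "n - t = 2 * j + 1" by (rule oddE)
  \<comment> \<open>Then \<open>Suc i\<close> is the number of occupied positions, and the quotient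
    in the statement is \<open>i / 2\<close>.\<close>
  define i where "i = j - 2"
  have i: "n = t + 2 * Suc i + 3" "1 \<le> i" using \<open>n - t = 2 * j + 1\<close> odd by (auto simp: i_def)
  have x: "(real n - real t - 5) / 4 = real i / 2" using i(1) by simp
  have "nat (\<lceil>real i / 2\<rceil> - 1) = Suc i div 2 - 1" using ceiling_half[of i] by (simp add: nat_diff_distrib')
  moreover have "nat (\<lfloor>real i / 2\<rfloor> + 1) = (Suc i + 1) div 2" using floor_half[of i] by (simp add: nat_add_distrib)
  ultimately show "isomorphic T (F_graph n (nat (\<lceil>(real n - real t - 5) / 4\<rceil> - 1))
      (nat (\<lfloor>(real n - real t - 5) / 4\<rfloor> + 1)))"
    unfolding x using minimal_isomorphic_F[OF assms(2,3) i(1)] i(2) by simp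
next
  assume "even (n - t)"
  then obtain j where "n - t = 2 * j" by blast
  define k where "k = j - 1"
  have k: "n = t + 2 * k + 2" "1 \<le> k" using \<open>n - t = 2 * j\<close> assms(1) by (auto simp: k_def)
  have x: "(real n - real t) / 4 - 1 / 2 = real k / 2" using k(1) by (simp add: field_simps)
  show "isomorphic T (C_graph n (nat \<lceil>(real n - real t) / 4 - 1 / 2\<rceil>)
      (nat \<lfloor>(real n - real t) / 4 - 1 / 2\<rfloor>))"
    unfolding x ceiling_half floor_half by (rule minimal_isomorphic_C[OF assms(2,3) k])
qed

end
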